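(* Let $\overline{\Omega}=\Omega\cup\partial\Omega$, let $f\in C^6(\overline{\Omega})$, let $u\in C^8(\overline{\Omega})$ be a solution of the Dirichlet problem $$\partial_x^2u+\partial_y^2u+K^2u=f\ \text{ in }\Omega,\qquad u=\Phi\ \text{ on }\partial\Omega,$$ and let $U_{i,j}$ be the solution of the difference scheme $\mathcal{L}_{i,j}U_{i,j}=F_{i,j}$ ($1\le i,j\le N-1$) with $U_{i,j}=\Phi(x_i,y_j)$ on $\partial\Omega_h$. Then for sufficiently small $Kh$ (i.e. there is $\varepsilon>0$ such that the following holds whenever $0<Kh<\varepsilon$), where $K$ is the wave number and $h$ the grid size, $$\|\mathbf{u}-\mathbf{U}\|_\infty\le C_1^{(1)}h^6+C_2^{(1)}h^6\,\|\partial^8u\|_{\infty,\Omega_h^0}$$ for some constants $C_1^{(1)},C_2^{(1)}$ independent of $h$.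
   Context: $\Omega=[a,b]\times[c,d]$ is a rectangle and $K$ is a constant. The grid $\Omega_h$ consists of the points $(x_i,y_j)$, $x_i=a+ih$, $y_j=c+jh$, $0\le i,j\le N$ (with $x_N=b$, $y_N=d$); $\Omega_h^0$ is the set of interior points ($1\le i,j\le N-1$) and $\partial\Omega_h$ the boundary grid points. $\delta_x^2\varphi_{i,j}=\frac{\varphi_{i-1,j}-2\varphi_{i,j}+\varphi_{i+1,j}}{h^2}$, $\delta_y^2\varphi_{i,j}=\frac{\varphi_{i,j-1}-2\varphi_{i,j}+\varphi_{i,j+1}}{h^2}$, and $\delta_x^2\delta_y^2$ is their composition. The operator is $$\mathcal{L}=-\alpha_1(\delta_x^2+\delta_y^2)-\alpha_2\delta_x^2\delta_y^2-K^2\alpha_3$$ and $$F_{i,j}=-\beta_1f_{i,j}-\beta_2(\delta_x^2+\delta_y^2)f_{i,j}-\beta_3\delta_x^2\delta_y^2f_{i,j}-\beta_4(\partial_x^2+\partial_y^2)f_{i,j}-\beta_5(\delta_x^2\partial_x^2+\delta_y^2\partial_y^2)f_{i,j},$$ with $\alpha_1=1+\frac{K^6h^6}{20160}$, $\alpha_2=\frac{h^2}{6}\left(1+\frac{K^2h^2}{30}+\frac{K^4h^4}{840}\right)$, $\alpha_3=1-\frac{K^2h^2}{12}+\frac{K^4h^4}{360}$, $\beta_1=1-\frac{K^2h^2}{12}+\frac{K^4h^4}{360}$, $\beta_2=\frac{K^4h^6}{20160}$, $\beta_3=\frac{h^4}{90}\left(1+\frac{K^2h^2}{112}\right)$, $\beta_4=\frac{h^2}{12}\left(1-\frac{K^2h^2}{30}\right)$,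 $\beta_5=\frac{h^4}{360}\left(1-\frac{K^2h^2}{56}\right)$. Norms: $\|\mathbf{u}-\mathbf{U}\|_\infty=\max_{0\le i,j\le N}|u(x_i,y_j)-U_{i,j}|$ and $$\|\partial^pu\|_{\infty,\Omega_h^0}=\sup\left\{\left|\frac{\partial^pu}{\partial x^{r_1}\partial y^{r_2}}(x,y)\right|:(x,y)\in\Omega_h^0,\ r_1+r_2=p,\ r_1,r_2\in\{0,\dots,p\}\right\}.$$
   Formalization: The formal theorem also assumes that u is the only C^8 solution of the Dirichlet problem (K^2 is not a Dirichlet eigenvalue); otherwise the claim fails, e.g. on [0,π]^2 with K^2=2, f=Φ=0, u=sin x sin y, U=0. *)

theory Defs
  imports "HOL-Analysis.Analysis"
begin

text \<open>Partial derivatives of functions on a closed rectangle \<open>I \<times> J\<close>: at interior points these are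
  the usual ones, on the boundary the one-sided ones (equivalently, the continuous extensions from
  the interior, for functions in \<open>C\<^sup>1\<close> of the closed rectangle).  The boundary values are needed because
  the right-hand side of the scheme applies \<open>\<delta>\<^sub>x\<^sup>2\<close> to \<open>\<partial>\<^sub>x\<^sup>2 f\<close> next to the boundary.\<close>

definition dx :: "real set \<Rightarrow> (real \<times> real \<Rightarrow> real) \<Rightarrow> real \<times> real \<Rightarrow> real" where
  "dx I u = (\<lambda>(x, y). vector_derivative (\<lambda>t. u (t, y)) (at x within I))"

definition dy :: "real set \<Rightarrow> (real \<times> real \<Rightarrow> real) \<Rightarrow> real \<times> real \<Rightarrow> real" where
  "dy J u = (\<lambda>(x, y). vector_derivative (\<lambda>t. u (x, t)) (at y within J))"

text \<open>\<open>u \<in> C\<^sup>k(I \<times> J)\<close>: all partial derivatives of order at most \<open>k\<close>, taken in any order, exist and are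
  continuous on \<open>I \<times> J\<close>.\<close>

primrec C_k_on :: "nat \<Rightarrow> real set \<Rightarrow> real set \<Rightarrow> (real \<times> real \<Rightarrow> real) \<Rightarrow> bool" where
  "C_k_on 0 I J u \<longleftrightarrow> continuous_on (I \<times> J) u"
| "C_k_on (Suc k) I J u \<longleftrightarrow>
     continuous_on (I \<times> J) u \<and>
     (\<forall>x\<in>I. \<forall>y\<in>J. (\<lambda>t. u (t, y)) differentiable (at x within I) \<and>
                   (\<lambda>t. u (x, t)) differentiable (at y within J)) \<and>
     C_k_on k I J (dx I u) \<and> C_k_on k I J (dy J u)"

definition helmholtz_dirichlet ::
  "real \<Rightarrow> real set \<Rightarrow> real set \<Rightarrow> (real \<times> real \<Rightarrow> real) \<Rightarrow> (real \<times> real \<Rightarrow> real) \<Rightarrow>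
   (real \<times> real \<Rightarrow> real) \<Rightarrow> bool" where
  "helmholtz_dirichlet K I J f \<Phi> u \<longleftrightarrow>
     (\<forall>p\<in>interior (I \<times> J). (dx I ^^ 2) u p + (dy J ^^ 2) u p + K^2 * u p = f p) \<and>
     (\<forall>p\<in>frontier (I \<times> J). u p = \<Phi> p)"

definition grid_pt :: "real \<Rightarrow> real \<Rightarrow> real \<Rightarrow> nat \<Rightarrow> nat \<Rightarrow> real \<times> real" where
  "grid_pt a c h i j = (a + real i * h, c + real j * h)"

text \<open>The difference operators are only meaningful at indices \<open>\<ge> 1\<close> in the differenced direction
  (subtraction on \<open>nat\<close> truncates); they are only used there.\<close>

definition \<delta>x2 :: "real \<Rightarrow> (nat \<Rightarrow> nat \<Rightarrow> real) \<Rightarrow> nat \<Rightarrow> nat \<Rightarrow> real" where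
  "\<delta>x2 h \<phi> i j = (\<phi> (i - 1) j - 2 * \<phi> i j + \<phi> (i + 1) j) / h^2"

definition \<delta>y2 :: "real \<Rightarrow> (nat \<Rightarrow> nat \<Rightarrow> real) \<Rightarrow> nat \<Rightarrow> nat \<Rightarrow> real" where
  "\<delta>y2 h \<phi> i j = (\<phi> i (j - 1) - 2 * \<phi> i j + \<phi> i (j + 1)) / h^2"

definition \<alpha>1 :: "real \<Rightarrow> real \<Rightarrow> real" where
  "\<alpha>1 K h = 1 + K^6 * h^6 / 20160"

definition \<alpha>2 :: "real \<Rightarrow> real \<Rightarrow> real" where
  "\<alpha>2 K h = h^2 / 6 * (1 + K^2 * h^2 / 30 + K^4 * h^4 / 840)"

definition \<alpha>3 :: "real \<Rightarrow> real \<Rightarrow> real" where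
  "\<alpha>3 K h = 1 - K^2 * h^2 / 12 + K^4 * h^4 / 360"

definition \<beta>1 :: "real \<Rightarrow> real \<Rightarrow> real" where
  "\<beta>1 K h = 1 - K^2 * h^2 / 12 + K^4 * h^4 / 360"

definition \<beta>2 :: "real \<Rightarrow> real \<Rightarrow> real" where
  "\<beta>2 K h = K^4 * h^6 / 20160"

definition \<beta>3 :: "real \<Rightarrow> real \<Rightarrow> real" where
  "\<beta>3 K h = h^4 / 90 * (1 + K^2 * h^2 / 112)"

definition \<beta>4 :: "real \<Rightarrow> real \<Rightarrow> real" where
  "\<beta>4 K h = h^2 / 12 * (1 - K^2 * h^2 / 30)"

definition \<beta>5 :: "real \<Rightarrow> real \<Rightarrow> real" where
  "\<beta>5 K h = h^4 / 360 * (1 - K^2 * h^2 / 56)"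

definition scheme_op :: "real \<Rightarrow> real \<Rightarrow> (nat \<Rightarrow> nat \<Rightarrow> real) \<Rightarrow> nat \<Rightarrow> nat \<Rightarrow> real" where
  "scheme_op K h U i j =
     - \<alpha>1 K h * (\<delta>x2 h U i j + \<delta>y2 h U i j)
     - \<alpha>2 K h * \<delta>x2 h (\<delta>y2 h U) i j
     - K^2 * \<alpha>3 K h * U i j"

definition scheme_rhs ::
  "real \<Rightarrow> real \<Rightarrow> (nat \<Rightarrow> nat \<Rightarrow> real) \<Rightarrow> (nat \<Rightarrow> nat \<Rightarrow> real) \<Rightarrow> (nat \<Rightarrow> nat \<Rightarrow> real) \<Rightarrow>
   nat \<Rightarrow> nat \<Rightarrow> real" where
  "scheme_rhs K h f fxx fyy i j =
     - \<beta>1 K h * f i j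
     - \<beta>2 K h * (\<delta>x2 h f i j + \<delta>y2 h f i j)
     - \<beta>3 K h * \<delta>x2 h (\<delta>y2 h f) i j
     - \<beta>4 K h * (fxx i j + fyy i j)
     - \<beta>5 K h * (\<delta>x2 h fxx i j + \<delta>y2 h fyy i j)"

text \<open>The grid covers \<open>[a, a + N h] \<times> [c, c + N h]\<close>.\<close>

definition difference_scheme ::
  "real \<Rightarrow> real \<Rightarrow> real \<Rightarrow> real \<Rightarrow> real \<Rightarrow> (real \<times> real \<Rightarrow> real) \<Rightarrow> (real \<times> real \<Rightarrow> real) \<Rightarrow>
   nat \<Rightarrow> real \<Rightarrow> (nat \<Rightarrow> nat \<Rightarrow> real) \<Rightarrow> bool" where
  "difference_scheme K a b c d f \<Phi> N h U \<longleftrightarrow>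
     (\<forall>i\<in>{1..N-1}. \<forall>j\<in>{1..N-1}.
        scheme_op K h U i j =
        scheme_rhs K h
          (\<lambda>i j. f (grid_pt a c h i j))
          (\<lambda>i j. (dx {a..b} ^^ 2) f (grid_pt a c h i j))
          (\<lambda>i j. (dy {c..d} ^^ 2) f (grid_pt a c h i j)) i j) \<and>
     (\<forall>i\<in>{0..N}. \<forall>j\<in>{0..N}. i = 0 \<or> i = N \<or> j = 0 \<or> j = N \<longrightarrow>
        U i j = \<Phi> (grid_pt a c h i j))"

definition grid_error ::
  "real \<Rightarrow> real \<Rightarrow> nat \<Rightarrow> real \<Rightarrow> (real \<times> real \<Rightarrow> real) \<Rightarrow> (nat \<Rightarrow> nat \<Rightarrow> real) \<Rightarrow> real" where
  "grid_error a c N h u U =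
     Max {\<bar>u (grid_pt a c h i j) - U i j\<bar> | i j. i \<in> {0..N} \<and> j \<in> {0..N}}"

definition interior_deriv_norm ::
  "real \<Rightarrow> real \<Rightarrow> real \<Rightarrow> real \<Rightarrow> nat \<Rightarrow> real \<Rightarrow> nat \<Rightarrow> (real \<times> real \<Rightarrow> real) \<Rightarrow> real" where
  "interior_deriv_norm a b c d N h p u =
     Sup {\<bar>(dx {a..b} ^^ r1) ((dy {c..d} ^^ r2) u) (grid_pt a c h i j)\<bar> | i j r1 r2.
            i \<in> {1..N-1} \<and> j \<in> {1..N-1} \<and> r1 + r2 = p}"

end

theory Submission
  imports Defs "HOL-Real_Asymp.Real_Asymp"
begin

text \<open>The error \<open>v = u - U\<close> vanishes on the boundary grid points and satisfies \<open>L v = \<tau>\<close>, where \<open>L\<close> is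
  the operator of the scheme and \<open>\<tau>\<close> its truncation error at \<open>u\<close>.  The theorem is
  consistency, \<open>\<bar>\<tau>\<bar> \<le> B h\<^sup>6\<close>, together with stability, \<open>max \<bar>v\<bar> \<le> C max \<bar>\<tau>\<bar>\<close> with \<open>C\<close>
  independent of \<open>h\<close>.

  Consistency (\<open>truncation_error_order_6\<close>).  Taylor expansion replaces every difference quotient by
  even partial derivatives of \<open>u\<close> and \<open>f\<close>, and \<open>f = u\<^bsub>xx\<^esub> + u\<^bsub>yy\<^esub> + K\<^sup>2 u\<close> turns the derivatives of
  \<open>f\<close> into derivatives of \<open>u\<close>.  The coefficients of the scheme are such that all terms below \<open>h\<^sup>6\<close>
  then cancel (\<open>compact_scheme_cancellation\<close>).  The stencil reaches the boundary, so
  the expansion is needed on the closed rectangle, with one-sided derivatives at its edges; this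
  includes the equation itself (\<open>helmholtz_on_closed_rectangle\<close>) and the symmetry of mixed
  partial derivatives (\<open>mixed_partials_commute\<close>).

  Stability (\<open>discrete_stability\<close>).  The operator is indefinite, so there is no maximum principle.
  But the existence of a grid forces the rectangle to be a square of some side \<open>L\<close>, and on a square grid
  the products of discrete sines diagonalise the scheme.  For small \<open>h\<close> the
  eigenvalue of index \<open>(m, n)\<close> is at least \<open>\<gamma> (m\<^sup>2 + n\<^sup>2)\<close> in modulus, with \<open>\<gamma> > 0\<close> independent of
  \<open>h\<close> (\<open>scheme_eig_bounded_below\<close>): for large \<open>m\<^sup>2 + n\<^sup>2\<close> the elliptic part dominates \<open>K\<^sup>2\<close>,
  and each of the finitely many other eigenvalues tends to \<open>(\<pi>/L)\<^sup>2 (m\<^sup>2 + n\<^sup>2) - K\<^sup>2\<close>.  This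
  limit is not \<open>0\<close>, since otherwise \<open>sin (\<pi> m (x - a) / L) sin (\<pi> n (y - c) / L)\<close> could be added to \<open>u\<close>,
  against the uniqueness of the solution (\<open>unique_imp_nonresonant\<close>).  Parseval and Cauchy-Schwarz convert
  this lower bound into a bound of the maximum norm without loss of a power of \<open>h\<close>, because
  \<open>\<Sum> 1 / (m\<^sup>2 + n\<^sup>2)\<^sup>2\<close> converges.\<close>

section \<open>The discrete sine transform and stability\<close>

definition dsin :: "nat \<Rightarrow> nat \<Rightarrow> nat \<Rightarrow> real" where
  "dsin N m i = sin (pi * real m * real i / real N)"

lemma dsin_commute: "dsin N m i = dsin N i m"
  by (simp add: dsin_def mult_ac)

lemma dsin_0 [simp]: "dsin N m 0 = 0" "dsin N 0 m = 0"
  by (simp_all add: dsin_def)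

lemma dsin_N [simp]: "N > 0 \<Longrightarrow> dsin N m N = 0"
  by (simp add: dsin_def)

lemma abs_dsin_le_1: "\<bar>dsin N m i\<bar> \<le> 1"
  by (simp add: dsin_def)

text \<open>Multiplying by \<open>2 sin (\<theta>/2)\<close> makes the sum telescope.  Only the parity of \<open>k\<close> matters for the value,
  which is why the two cosine sums of \<open>2 sin \<alpha> sin \<beta> = cos (\<alpha> - \<beta>) - cos (\<alpha> + \<beta>)\<close> cancel below:
  \<open>m - n\<close> and \<open>m + n\<close> have the same parity.\<close>

lemma sum_cos_multiples:
  assumes "0 < k" "k < 2 * N"
  shows "(\<Sum>i<N. cos (pi * real k * real i / real N)) = (1 - (-1) ^ k) / 2"
proof -
  define \<theta> where "\<theta> = pi * real k / real N"
  have N: "real N > 0" using assms by simp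
  have "0 < \<theta> / 2" "\<theta> / 2 < pi"
    using assms N by (simp_all add: \<theta>_def field_simps)
  then have s: "sin (\<theta> / 2) > 0" by (rule sin_gt_zero)
  have tele: "2 * sin (\<theta> / 2) * cos (real i * \<theta>)
                = sin (real (Suc i) * \<theta> - \<theta> / 2) - sin (real i * \<theta> - \<theta> / 2)" for i
  proof -
    have "real (Suc i) * \<theta> - \<theta> / 2 = real i * \<theta> + \<theta> / 2" by (simp add: algebra_simps)
    then show ?thesis by (simp add: sin_add sin_diff)
  qed
  have "2 * sin (\<theta> / 2) * (\<Sum>i<N. cos (real i * \<theta>)) = sin (real N * \<theta> - \<theta> / 2) + sin (\<theta> / 2)"
    unfolding sum_distrib_left tele by (subst sum_lessThan_telescope) simp
  also have "real N * \<theta> = pi * real k" using N by (simp add: \<theta>_def)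
  also have "sin (pi * real k - \<theta> / 2) = - ((-1) ^ k * sin (\<theta> / 2))"
    by (simp add: sin_diff mult.commute[of pi])
  finally have "2 * sin (\<theta> / 2) * (\<Sum>i<N. cos (real i * \<theta>)) = 2 * sin (\<theta> / 2) * ((1 - (-1) ^ k) / 2)"
    by (simp add: algebra_simps)
  then have "(\<Sum>i<N. cos (real i * \<theta>)) = (1 - (-1) ^ k) / 2"
    using s by simp
  then show ?thesis by (simp add: \<theta>_def mult_ac)
qed

lemma dsin_orthogonal:
  assumes "m \<in> {1..<N}" "n \<in> {1..<N}"
  shows "(\<Sum>i\<in>{1..<N}. dsin N m i * dsin N n i) = (if m = n then real N / 2 else 0)"
proof -
  have *: "(\<Sum>i\<in>{1..<N}. dsin N m i * dsin N n i) = (if m = n then real N / 2 else 0)"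
    if "n \<in> {1..<N}" "m \<in> {1..<N}" "n \<le> m" for m n
  proof -
    have "(\<Sum>i\<in>{1..<N}. dsin N m i * dsin N n i) = (\<Sum>i<N. dsin N m i * dsin N n i)"
      by (rule sum.mono_neutral_left) (auto simp: not_le)
    also have "\<dots> = (\<Sum>i<N. cos (pi * real (m - n) * real i / real N)
                          - cos (pi * real (m + n) * real i / real N)) / 2"
      unfolding sum_divide_distrib
    proof (rule sum.cong)
      fix i
      let ?p = "pi * real m * real i / real N" and ?q = "pi * real n * real i / real N"
      have e: "pi * real (m - n) * real i / real N = ?p - ?q" "pi * real (m + n) * real i / real N = ?p + ?q"
        using that by (simp_all add: of_nat_diff algebra_simps diff_divide_distrib add_divide_distrib)
      show "dsin N m i * dsin N n i = (cos (pi * real (m - n) * real i / real N)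
                          - cos (pi * real (m + n) * real i / real N)) / 2"
        unfolding e dsin_def cos_diff cos_add by simp
    qed simp
    also have "\<dots> = ((\<Sum>i<N. cos (pi * real (m - n) * real i / real N)) - (1 - (-1) ^ (m + n)) / 2) / 2"
      using that by (subst sum_cos_multiples[of "m + n", symmetric]) (auto simp: sum_subtractf)
    also have "\<dots> = (if m = n then real N / 2 else 0)"
    proof (cases "m = n")
      case True
      have "(-1 :: real) ^ (n + n) = 1" by simp
      then show ?thesis using True by simp
    next
      case False
      have "(-1 :: real) ^ (m - n) = (-1) ^ (m + n)"
        using that by (simp add: minus_one_power_iff)
      then show ?thesis using that False by (subst sum_cos_multiples) auto
    qed
    finally show ?thesis .
  qed
  show ?thesis
  proof (cases "n \<le> m")
    case True
    then show ?thesis using * assms by blast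
  next
    case False
    then show ?thesis using *[of m n] assms by (simp add: mult.commute)
  qed
qed

text \<open>The matrix \<open>dsin N m i\<close> is symmetric, so the orthogonality of its rows also inverts it.\<close>

lemma dsin_inversion:
  assumes "i \<in> {1..<N}"
  shows "v i = 2 / real N * (\<Sum>m\<in>{1..<N}. dsin N m i * (\<Sum>k\<in>{1..<N}. dsin N m k * v k))"
proof -
  have "(\<Sum>m\<in>{1..<N}. dsin N m i * (\<Sum>k\<in>{1..<N}. dsin N m k * v k))
      = (\<Sum>k\<in>{1..<N}. v k * (\<Sum>m\<in>{1..<N}. dsin N i m * dsin N k m))"
  proof -
    have "dsin N m i * (\<Sum>k\<in>{1..<N}. dsin N m k * v k)
        = (\<Sum>k\<in>{1..<N}. v k * (dsin N i m * dsin N k m))" for m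
      unfolding dsin_commute[of N m] by (simp add: sum_distrib_left mult_ac)
    then have "(\<Sum>m\<in>{1..<N}. dsin N m i * (\<Sum>k\<in>{1..<N}. dsin N m k * v k))
        = (\<Sum>m\<in>{1..<N}. \<Sum>k\<in>{1..<N}. v k * (dsin N i m * dsin N k m))" by (simp only:)
    also have "\<dots> = (\<Sum>k\<in>{1..<N}. v k * (\<Sum>m\<in>{1..<N}. dsin N i m * dsin N k m))"
      by (subst sum.swap) (simp only: sum_distrib_left)
    finally show ?thesis .
  qed
  also have "\<dots> = (\<Sum>k\<in>{1..<N}. if i = k then v k * (real N / 2) else 0)"
    by (rule sum.cong[OF refl], subst dsin_orthogonal[OF assms]) auto
  also have "\<dots> = v i * (real N / 2)" using assms by simp
  finally have "(\<Sum>m\<in>{1..<N}. dsin N m i * (\<Sum>k\<in>{1..<N}. dsin N m k * v k)) = v i * (real N / 2)" .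
  then show ?thesis using assms by (simp only:) simp
qed

lemma dsin_parseval:
  "(\<Sum>m\<in>{1..<N}. (\<Sum>k\<in>{1..<N}. dsin N m k * v k)\<^sup>2) = real N / 2 * (\<Sum>k\<in>{1..<N}. (v k)\<^sup>2)"
proof -
  have "(\<Sum>m\<in>{1..<N}. (\<Sum>k\<in>{1..<N}. dsin N m k * v k)\<^sup>2)
      = (\<Sum>m\<in>{1..<N}. \<Sum>k\<in>{1..<N}. v k * (dsin N m k * (\<Sum>l\<in>{1..<N}. dsin N m l * v l)))"
    unfolding power2_eq_square sum_distrib_right by (simp only: mult_ac)
  also have "\<dots> = (\<Sum>k\<in>{1..<N}. v k * (\<Sum>m\<in>{1..<N}. dsin N m k * (\<Sum>l\<in>{1..<N}. dsin N m l * v l)))"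
    by (subst sum.swap) (simp only: sum_distrib_left[of "v _"])
  also have "\<dots> = (\<Sum>k\<in>{1..<N}. v k * (real N / 2 * v k))"
  proof (rule sum.cong)
    fix k assume "k \<in> {1..<N}"
    then show "v k * (\<Sum>m\<in>{1..<N}. dsin N m k * (\<Sum>l\<in>{1..<N}. dsin N m l * v l)) = v k * (real N / 2 * v k)"
      using dsin_inversion[of k N v] by simp
  qed simp
  also have "\<dots> = real N / 2 * (\<Sum>k\<in>{1..<N}. (v k)\<^sup>2)"
    by (simp add: sum_distrib_left power2_eq_square mult_ac)
  finally show ?thesis .
qed

text \<open>The second difference is symmetric on sequences that vanish at both ends.\<close>

lemma second_difference_by_parts:
  fixes f g :: "nat \<Rightarrow> real"
  assumes "f 0 = 0" "f N = 0" "g 0 = 0" "g N = 0"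
  shows "(\<Sum>i\<in>{1..<N}. f i * (g (i - 1) - 2 * g i + g (i + 1)))
       = (\<Sum>i\<in>{1..<N}. (f (i - 1) - 2 * f i + f (i + 1)) * g i)"
proof -
  have shift: "(\<Sum>i\<in>{1..<N}. f i * g (i + 1)) = (\<Sum>i\<in>{1..<N}. f (i - 1) * g i)"
    if "f 0 = 0" "g N = 0" for f g :: "nat \<Rightarrow> real"
  proof (cases "N = 0")
    case False
    then obtain M where N: "N = Suc M" by (cases N) auto
    have "(\<Sum>i\<in>{1..<N}. f i * g (i + 1)) = (\<Sum>i<N. f i * g (i + 1))"
      by (rule sum.mono_neutral_left) (use that in \<open>auto simp: not_le\<close>)
    also have "\<dots> = (\<Sum>i<M. f i * g (i + 1))" using that by (simp add: N)
    also have "\<dots> = (\<Sum>i\<in>{1..<N}. f (i - 1) * g i)"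
      unfolding N by (rule sum.reindex_bij_witness[of _ "\<lambda>i. i - 1" Suc]) auto
    finally show ?thesis .
  qed simp
  have "(\<Sum>i\<in>{1..<N}. f i * (g (i - 1) - 2 * g i + g (i + 1)))
      = (\<Sum>i\<in>{1..<N}. g (i - 1) * f i) - (\<Sum>i\<in>{1..<N}. 2 * f i * g i) + (\<Sum>i\<in>{1..<N}. f i * g (i + 1))"
    unfolding sum_subtractf[symmetric] sum.distrib[symmetric]
    by (rule sum.cong[OF refl]) (simp only: algebra_simps)
  also have "\<dots> = (\<Sum>i\<in>{1..<N}. g i * f (i + 1)) - (\<Sum>i\<in>{1..<N}. 2 * f i * g i) + (\<Sum>i\<in>{1..<N}. f (i - 1) * g i)"
    using shift[of g f] shift[of f g] assms by (simp only:)
  also have "\<dots> = (\<Sum>i\<in>{1..<N}. (f (i - 1) - 2 * f i + f (i + 1)) * g i)"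
    unfolding sum_subtractf[symmetric] sum.distrib[symmetric]
    by (rule sum.cong[OF refl]) (simp only: algebra_simps)
  finally show ?thesis .
qed

text \<open>The addition theorem gives the factor \<open>2 cos s - 2 = -4 sin\<^sup>2 (s/2)\<close>.\<close>

lemma dsin_second_difference:
  assumes "i \<ge> 1"
  shows "dsin N m (i - 1) - 2 * dsin N m i + dsin N m (i + 1)
       = - (2 * sin (pi * real m / (2 * real N)))\<^sup>2 * dsin N m i"
proof -
  define s where "s = pi * real m / real N"
  have "dsin N m (i - 1) = sin (s * real i - s)" "dsin N m (i + 1) = sin (s * real i + s)"
       "dsin N m i = sin (s * real i)"
    using assms by (simp_all add: dsin_def s_def of_nat_diff algebra_simps diff_divide_distrib add_divide_distrib)
  then have "dsin N m (i - 1) - 2 * dsin N m i + dsin N m (i + 1) = (2 * cos s - 2) * dsin N m i"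
    by (simp add: sin_add sin_diff algebra_simps)
  also have "cos s = 1 - 2 * (sin (s / 2))\<^sup>2"
    using cos_double_sin[of "s / 2"] by simp
  finally show ?thesis by (simp add: s_def power2_eq_square mult_ac)
qed

definition dsin_transform :: "nat \<Rightarrow> (nat \<Rightarrow> nat \<Rightarrow> real) \<Rightarrow> nat \<Rightarrow> nat \<Rightarrow> real" where
  "dsin_transform N v m n = (\<Sum>i\<in>{1..<N}. dsin N m i * (\<Sum>j\<in>{1..<N}. dsin N n j * v i j))"

lemma dsin_transform_inversion:
  assumes "i \<in> {1..<N}" "j \<in> {1..<N}"
  shows "v i j = 4 / (real N)\<^sup>2 *
     (\<Sum>m\<in>{1..<N}. \<Sum>n\<in>{1..<N}. dsin N m i * dsin N n j * dsin_transform N v m n)"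
proof -
  let ?V = "\<lambda>n i. \<Sum>j\<in>{1..<N}. dsin N n j * v i j"
  have "v i j = 2 / real N * (\<Sum>n\<in>{1..<N}. dsin N n j * ?V n i)"
    using assms by (intro dsin_inversion)
  also have "\<dots> = 2 / real N * (\<Sum>n\<in>{1..<N}. dsin N n j *
                  (2 / real N * (\<Sum>m\<in>{1..<N}. dsin N m i * dsin_transform N v m n)))"
    unfolding dsin_transform_def using assms(1) by (subst dsin_inversion[of i N]) auto
  also have "\<dots> = 4 / (real N)\<^sup>2 * (\<Sum>n\<in>{1..<N}. \<Sum>m\<in>{1..<N}. dsin N m i * dsin N n j * dsin_transform N v m n)"
    by (simp add: sum_distrib_left power2_eq_square mult_ac)
  finally show ?thesis by (subst sum.swap)
qed

lemma dsin_transform_parseval: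
  "(\<Sum>m\<in>{1..<N}. \<Sum>n\<in>{1..<N}. (dsin_transform N v m n)\<^sup>2)
     = (real N)\<^sup>2 / 4 * (\<Sum>i\<in>{1..<N}. \<Sum>j\<in>{1..<N}. (v i j)\<^sup>2)"
proof -
  have "(\<Sum>m\<in>{1..<N}. \<Sum>n\<in>{1..<N}. (dsin_transform N v m n)\<^sup>2)
      = (\<Sum>n\<in>{1..<N}. real N / 2 * (\<Sum>i\<in>{1..<N}. (\<Sum>j\<in>{1..<N}. dsin N n j * v i j)\<^sup>2))"
    by (subst sum.swap) (simp only: dsin_transform_def dsin_parseval)
  also have "\<dots> = real N / 2 * (\<Sum>i\<in>{1..<N}. \<Sum>n\<in>{1..<N}. (\<Sum>j\<in>{1..<N}. dsin N n j * v i j)\<^sup>2)"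
    by (subst sum_distrib_left[symmetric], subst sum.swap) (rule refl)
  also have "\<dots> = real N / 2 * (real N / 2 * (\<Sum>i\<in>{1..<N}. \<Sum>j\<in>{1..<N}. (v i j)\<^sup>2))"
    by (simp only: dsin_parseval sum_distrib_left[symmetric])
  finally show ?thesis by (simp add: power2_eq_square)
qed

definition zero_boundary :: "nat \<Rightarrow> (nat \<Rightarrow> nat \<Rightarrow> real) \<Rightarrow> bool" where
  "zero_boundary N v \<longleftrightarrow> (\<forall>i\<le>N. v i 0 = 0 \<and> v i N = 0 \<and> v 0 i = 0 \<and> v N i = 0)"

text \<open>The eigenvalue of \<open>- \<delta>\<^sub>x\<^sup>2\<close> (and of \<open>- \<delta>\<^sub>y\<^sup>2\<close>) on the \<open>m\<close>-th discrete sine.\<close>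

definition diff_eig :: "real \<Rightarrow> nat \<Rightarrow> nat \<Rightarrow> real" where
  "diff_eig h N m = (2 * sin (pi * real m / (2 * real N)) / h)\<^sup>2"

text \<open>Summation by parts moves the second difference from \<open>v\<close> to the sine, where it acts as a scalar.\<close>

lemma dsin_transform_\<delta>x2:
  assumes "N > 0" "\<And>j. j \<in> {1..<N} \<Longrightarrow> v 0 j = 0 \<and> v N j = 0"
  shows "dsin_transform N (\<delta>x2 h v) m n = - diff_eig h N m * dsin_transform N v m n"
proof -
  let ?V = "\<lambda>i. \<Sum>j\<in>{1..<N}. dsin N n j * v i j"
  have "(\<Sum>j\<in>{1..<N}. dsin N n j * \<delta>x2 h v i j) = (?V (i - 1) - 2 * ?V i + ?V (i + 1)) / h\<^sup>2" for i
    unfolding \<delta>x2_def sum_distrib_left[of 2] sum_subtractf[symmetric] sum.distrib[symmetric] sum_divide_distrib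
    by (rule sum.cong[OF refl]) (simp add: algebra_simps)
  then have "dsin_transform N (\<delta>x2 h v) m n
      = (\<Sum>i\<in>{1..<N}. dsin N m i * (?V (i - 1) - 2 * ?V i + ?V (i + 1))) / h\<^sup>2"
    by (simp only: dsin_transform_def sum_divide_distrib times_divide_eq_right)
  also have "\<dots> = (\<Sum>i\<in>{1..<N}. (dsin N m (i - 1) - 2 * dsin N m i + dsin N m (i + 1)) * ?V i) / h\<^sup>2"
    using assms by (subst second_difference_by_parts) auto
  also have "\<dots> = (\<Sum>i\<in>{1..<N}. - (2 * sin (pi * real m / (2 * real N)))\<^sup>2 * dsin N m i * ?V i) / h\<^sup>2"
    by (rule arg_cong[of _ _ "\<lambda>s. s / h\<^sup>2"], rule sum.cong) (simp_all only: dsin_second_difference atLeastLessThan_iff)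
  also have "\<dots> = - diff_eig h N m * (\<Sum>i\<in>{1..<N}. dsin N m i * ?V i)"
    unfolding diff_eig_def power_divide by (simp only: mult.assoc sum_distrib_left[symmetric]) simp
  finally show ?thesis by (simp only: dsin_transform_def)
qed

lemma dsin_transform_transpose: "dsin_transform N (\<lambda>i j. v j i) m n = dsin_transform N v n m"
  unfolding dsin_transform_def sum_distrib_left by (subst sum.swap) (simp add: mult_ac)

lemma dsin_transform_\<delta>y2:
  assumes "N > 0" "\<And>i. i \<in> {1..<N} \<Longrightarrow> v i 0 = 0 \<and> v i N = 0"
  shows "dsin_transform N (\<delta>y2 h v) m n = - diff_eig h N n * dsin_transform N v m n"
proof -
  have "\<delta>y2 h v = (\<lambda>i j. \<delta>x2 h (\<lambda>i j. v j i) j i)"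
    by (simp add: \<delta>x2_def \<delta>y2_def fun_eq_iff)
  then have "dsin_transform N (\<delta>y2 h v) m n = dsin_transform N (\<delta>x2 h (\<lambda>i j. v j i)) n m"
    using dsin_transform_transpose[of N "\<delta>x2 h (\<lambda>i j. v j i)" m n] by (simp only:)
  also have "\<dots> = - diff_eig h N n * dsin_transform N (\<lambda>i j. v j i) n m"
    using assms by (intro dsin_transform_\<delta>x2) auto
  also have "\<dots> = - diff_eig h N n * dsin_transform N v m n"
    by (simp only: dsin_transform_transpose[of N v n m])
  finally show ?thesis .
qed

definition scheme_eig :: "real \<Rightarrow> real \<Rightarrow> nat \<Rightarrow> nat \<Rightarrow> nat \<Rightarrow> real" where
  "scheme_eig K h N m n = \<alpha>1 K h * (diff_eig h N m + diff_eig h N n)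
     - \<alpha>2 K h * diff_eig h N m * diff_eig h N n - K\<^sup>2 * \<alpha>3 K h"

lemma dsin_transform_add:
  "dsin_transform N (\<lambda>i j. v i j + w i j) m n = dsin_transform N v m n + dsin_transform N w m n"
  by (simp only: dsin_transform_def distrib_left sum.distrib)

lemma dsin_transform_scale:
  "dsin_transform N (\<lambda>i j. c * v i j) m n = c * dsin_transform N v m n"
  by (simp only: dsin_transform_def mult.left_commute[of _ c] sum_distrib_left[symmetric])

text \<open>In \<open>\<delta>\<^sub>x\<^sup>2 \<delta>\<^sub>y\<^sup>2 v\<close> the outer difference is applied to \<open>\<delta>\<^sub>y\<^sup>2 v\<close>, which still vanishes on the two
  sides \<open>i = 0\<close> and \<open>i = N\<close>; this is all that the transform in the \<open>x\<close>-direction requires.\<close>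

lemma dsin_transform_scheme_op:
  assumes "N > 0" "zero_boundary N v"
  shows "dsin_transform N (scheme_op K h v) m n = scheme_eig K h N m n * dsin_transform N v m n"
proof -
  have "scheme_op K h v = (\<lambda>i j. - \<alpha>1 K h * \<delta>x2 h v i j + (- \<alpha>1 K h * \<delta>y2 h v i j
      + (- \<alpha>2 K h * \<delta>x2 h (\<delta>y2 h v) i j + - (K\<^sup>2 * \<alpha>3 K h) * v i j)))"
    by (simp add: scheme_op_def fun_eq_iff algebra_simps)
  then have "dsin_transform N (scheme_op K h v) m n =
      - \<alpha>1 K h * dsin_transform N (\<delta>x2 h v) m n + (- \<alpha>1 K h * dsin_transform N (\<delta>y2 h v) m n
      + (- \<alpha>2 K h * dsin_transform N (\<delta>x2 h (\<delta>y2 h v)) m n + - (K\<^sup>2 * \<alpha>3 K h) * dsin_transform N v m n))"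
    by (simp only: dsin_transform_add dsin_transform_scale)
  moreover have "dsin_transform N (\<delta>x2 h v) m n = - diff_eig h N m * dsin_transform N v m n"
    using assms by (intro dsin_transform_\<delta>x2) (auto simp: zero_boundary_def)
  moreover have y: "dsin_transform N (\<delta>y2 h v) m n = - diff_eig h N n * dsin_transform N v m n"
    using assms by (intro dsin_transform_\<delta>y2) (auto simp: zero_boundary_def)
  moreover have "dsin_transform N (\<delta>x2 h (\<delta>y2 h v)) m n = - diff_eig h N m * dsin_transform N (\<delta>y2 h v) m n"
    using assms by (intro dsin_transform_\<delta>x2) (auto simp: zero_boundary_def \<delta>y2_def)
  ultimately have "dsin_transform N (scheme_op K h v) m n =
      - \<alpha>1 K h * (- diff_eig h N m * dsin_transform N v m n) + (- \<alpha>1 K h * (- diff_eig h N n * dsin_transform N v m n)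
      + (- \<alpha>2 K h * (- diff_eig h N m * (- diff_eig h N n * dsin_transform N v m n)) + - (K\<^sup>2 * \<alpha>3 K h) * dsin_transform N v m n))"
    by (simp only:)
  then show ?thesis unfolding scheme_eig_def by algebra
qed

lemma sum_inverse_squares_le: "(\<Sum>m\<in>{1..<N}. 1 / (real m)\<^sup>2) \<le> 2"
proof -
  have "(\<Sum>m\<in>{1..<Suc M}. 1 / (real m)\<^sup>2) \<le> 2 - 1 / real M" if "M \<ge> 1" for M
    using that
  proof (induction M rule: dec_induct)
    case (step k)
    have "1 / (real (Suc k))\<^sup>2 \<le> 1 / (real k * real (Suc k))"
      using step by (intro divide_left_mono) (auto simp: power2_eq_square)
    also have "\<dots> = 1 / real k - 1 / real (Suc k)"
      using step by (simp add: field_simps)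
    finally show ?case using step by simp
  qed simp
  note partial = this
  show ?thesis
  proof (cases "N \<le> 1")
    case False
    then obtain M where "N = Suc M" "M \<ge> 1" by (cases N) auto
    then show ?thesis using partial[of M] by (smt (verit) divide_nonneg_nonneg of_nat_0_le_iff)
  qed simp
qed

text \<open>Dividing by the eigenvalues bounds the transform of \<open>v\<close> by that of \<open>T = L v\<close> times \<open>1 / (2 c m n)\<close>,
  since \<open>m\<^sup>2 + n\<^sup>2 \<ge> 2 m n\<close>.  By Cauchy-Schwarz the sum of these bounds is at most the product of the
  \<open>l\<^sup>2\<close> norm of the transform of \<open>T\<close>, which Parseval bounds by \<open>N\<^sup>2 M / 2\<close>, and of the \<open>l\<^sup>2\<close> norm of
  \<open>1 / (2 c m n)\<close>, which is at most \<open>1 / c\<close>.  The factor \<open>N\<^sup>2\<close> is cancelled by the normalisation \<open>4 / N\<^sup>2\<close>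
  of the inverse transform.\<close>

lemma discrete_stability:
  assumes N: "N > 0" and v: "zero_boundary N v"
    and M: "\<And>i j. i \<in> {1..<N} \<Longrightarrow> j \<in> {1..<N} \<Longrightarrow> \<bar>scheme_op K h v i j\<bar> \<le> M"
    and c: "c > 0"
    and eig: "\<And>m n. m \<in> {1..<N} \<Longrightarrow> n \<in> {1..<N} \<Longrightarrow> \<bar>scheme_eig K h N m n\<bar> \<ge> c * ((real m)\<^sup>2 + (real n)\<^sup>2)"
    and ij: "i \<in> {1..<N}" "j \<in> {1..<N}"
  shows "\<bar>v i j\<bar> \<le> 2 * M / c"
proof -
  let ?I = "{1..<N}" and ?r = "\<lambda>p. 1 / (2 * c * real (fst p) * real (snd p))"
  define T where "T = scheme_op K h v"
  define That where "That = (\<lambda>p. dsin_transform N T (fst p) (snd p))"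
  have M0: "M \<ge> 0" using M[OF ij] by linarith
  have coeff: "\<bar>dsin_transform N v m n\<bar> \<le> \<bar>That (m, n)\<bar> * ?r (m, n)" if mn: "m \<in> ?I" "n \<in> ?I" for m n
  proof -
    have pos: "0 < 2 * c * real m * real n" using mn c by simp
    have "2 * c * real m * real n \<le> c * ((real m)\<^sup>2 + (real n)\<^sup>2)"
      using c sum_squares_bound[of "real m" "real n"] by (simp add: mult.assoc)
    also have "\<dots> \<le> \<bar>scheme_eig K h N m n\<bar>" by (rule eig[OF mn])
    finally have "2 * c * real m * real n * \<bar>dsin_transform N v m n\<bar>
        \<le> \<bar>scheme_eig K h N m n\<bar> * \<bar>dsin_transform N v m n\<bar>"
      by (rule mult_right_mono) simp
    also have "\<dots> = \<bar>That (m, n)\<bar>"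
      unfolding That_def T_def using dsin_transform_scheme_op[OF N v] by (simp add: abs_mult)
    finally show ?thesis using pos by (simp add: field_simps)
  qed
  have "(\<Sum>p\<in>?I \<times> ?I. (That p)\<^sup>2) = (real N)\<^sup>2 / 4 * (\<Sum>i\<in>?I. \<Sum>j\<in>?I. (T i j)\<^sup>2)"
    using dsin_transform_parseval[of N T] by (simp add: That_def sum.cartesian_product case_prod_beta)
  also have "\<dots> \<le> (real N)\<^sup>2 / 4 * (\<Sum>i\<in>?I. \<Sum>j\<in>?I. M\<^sup>2)"
    by (intro mult_left_mono sum_mono abs_le_square_iff[THEN iffD1]) (use M M0 in \<open>auto simp: T_def\<close>)
  also have "\<dots> = (real N)\<^sup>2 / 4 * (real (N - 1) * real (N - 1) * M\<^sup>2)"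
    using N by (simp add: of_nat_diff)
  also have "\<dots> \<le> (real N)\<^sup>2 / 4 * (real N * real N * M\<^sup>2)"
    by (intro mult_left_mono mult_right_mono mult_mono) auto
  also have "\<dots> = ((real N)\<^sup>2 * M / 2)\<^sup>2" by (simp add: power2_eq_square)
  finally have A: "(\<Sum>p\<in>?I \<times> ?I. (That p)\<^sup>2) \<le> ((real N)\<^sup>2 * M / 2)\<^sup>2" .
  have "(\<Sum>p\<in>?I \<times> ?I. (?r p)\<^sup>2) = (\<Sum>p\<in>?I \<times> ?I. (1 / (2 * c))\<^sup>2 * (1 / (real (fst p))\<^sup>2 * (1 / (real (snd p))\<^sup>2)))"
    by (rule sum.cong) (simp_all add: power_divide power_mult_distrib)
  also have "\<dots> = (1 / (2 * c))\<^sup>2 * ((\<Sum>m\<in>?I. 1 / (real m)\<^sup>2) * (\<Sum>n\<in>?I. 1 / (real n)\<^sup>2))"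
    by (subst sum_distrib_left[symmetric], subst sum_product) (simp only: sum.cartesian_product case_prod_beta')
  also have "\<dots> \<le> (1 / (2 * c))\<^sup>2 * (2 * 2)"
    by (intro mult_left_mono mult_mono sum_inverse_squares_le sum_nonneg) auto
  also have "\<dots> = (1 / c)\<^sup>2" by (simp add: power2_eq_square)
  finally have B: "(\<Sum>p\<in>?I \<times> ?I. (?r p)\<^sup>2) \<le> (1 / c)\<^sup>2" .
  have "(\<Sum>p\<in>?I \<times> ?I. \<bar>That p\<bar> * ?r p)\<^sup>2 \<le> (\<Sum>p\<in>?I \<times> ?I. \<bar>That p\<bar>\<^sup>2) * (\<Sum>p\<in>?I \<times> ?I. (?r p)\<^sup>2)"
    by (rule Cauchy_Schwarz_ineq_sum)
  also have "\<dots> \<le> ((real N)\<^sup>2 * M / 2)\<^sup>2 * (1 / c)\<^sup>2"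
    using A B by (intro mult_mono) (auto intro: sum_nonneg)
  also have "\<dots> = ((real N)\<^sup>2 * M / (2 * c))\<^sup>2" by (simp add: power_mult_distrib power_divide)
  finally have CS: "(\<Sum>p\<in>?I \<times> ?I. \<bar>That p\<bar> * ?r p) \<le> (real N)\<^sup>2 * M / (2 * c)"
    by (rule power2_le_imp_le) (use M0 c in simp)
  have "\<bar>v i j\<bar> = 4 / (real N)\<^sup>2 * \<bar>\<Sum>m\<in>?I. \<Sum>n\<in>?I. dsin N m i * dsin N n j * dsin_transform N v m n\<bar>"
    by (subst dsin_transform_inversion[OF ij]) (simp only: abs_mult, simp)
  also have "\<dots> \<le> 4 / (real N)\<^sup>2 * (\<Sum>m\<in>?I. \<Sum>n\<in>?I. \<bar>That (m, n)\<bar> * ?r (m, n))"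
  proof (intro mult_left_mono order_trans[OF sum_abs] sum_mono)
    fix m n assume mn: "m \<in> ?I" "n \<in> ?I"
    have "\<bar>dsin N m i * dsin N n j\<bar> \<le> 1 * 1"
      unfolding abs_mult by (intro mult_mono abs_dsin_le_1) auto
    then have "\<bar>dsin N m i * dsin N n j\<bar> * \<bar>dsin_transform N v m n\<bar> \<le> 1 * \<bar>dsin_transform N v m n\<bar>"
      by (intro mult_right_mono) auto
    then show "\<bar>dsin N m i * dsin N n j * dsin_transform N v m n\<bar> \<le> \<bar>That (m, n)\<bar> * ?r (m, n)"
      using coeff[OF mn] unfolding abs_mult by linarith
  qed simp
  also have "\<dots> = 4 / (real N)\<^sup>2 * (\<Sum>p\<in>?I \<times> ?I. \<bar>That p\<bar> * ?r p)"
    by (simp only: sum.cartesian_product case_prod_beta' prod.collapse)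
  also have "\<dots> \<le> 4 / (real N)\<^sup>2 * ((real N)\<^sup>2 * M / (2 * c))"
    by (intro mult_left_mono CS) simp
  also have "\<dots> = 2 * M / c" using N by simp
  finally show ?thesis .
qed

section \<open>Eigenvalues of the scheme\<close>

text \<open>A crude form of Jordan's inequality, from the Taylor remainder \<open>x\<^sup>3 / 6\<close> and \<open>x\<^sup>2 < 3\<close>.\<close>

lemma sin_ge_half:
  fixes x :: real
  assumes "0 \<le> x" "x \<le> pi / 2"
  shows "sin x \<ge> x / 2"
proof -
  have "\<bar>sin x - (\<Sum>m<3. sin_coeff m * x ^ m)\<bar> \<le> inverse (fact 3) * \<bar>x\<bar> ^ 3"
    by (rule Maclaurin_sin_bound)
  moreover have "(\<Sum>m<3. sin_coeff m * x ^ m) = x"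
    by (simp add: sin_coeff_def eval_nat_numeral)
  ultimately have "\<bar>sin x - x\<bar> \<le> x ^ 3 / 6"
    using assms by (simp add: fact_numeral)
  then have "sin x \<ge> x - x ^ 3 / 6" by linarith
  moreover have "pi \<le> 16 / 5" using pi_approx by simp
  then have "x * x \<le> (8 / 5) * (8 / 5)" using assms by (intro mult_mono) auto
  then have "x * (x * x) \<le> x * 3" using assms by (intro mult_left_mono) auto
  ultimately show ?thesis by (simp add: power3_eq_cube)
qed

text \<open>Up to a constant, the eigenvalue has the size \<open>(m / L)\<^sup>2\<close> of its continuous counterpart,
  uniformly in \<open>h\<close> and up to the highest frequency.\<close>

lemma diff_eig_bounds:
  assumes "h > 0" "real N * h = L" "m \<in> {1..<N}"
  shows "diff_eig h N m \<ge> 2 * (real m)\<^sup>2 / L\<^sup>2" "diff_eig h N m \<le> 4 / h\<^sup>2" "diff_eig h N m \<ge> 0"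
proof -
  define x where "x = pi * real m / (2 * real N)"
  have x: "0 \<le> x" "x \<le> pi / 2" using assms by (auto simp: x_def field_simps)
  have "real m / L * 1.5 \<le> real m / L * (pi / 2)"
    using assms pi_gt3 by (intro mult_left_mono) auto
  also have "\<dots> = 2 * (x / 2) / h" using assms by (auto simp: x_def field_simps)
  also have "\<dots> \<le> 2 * sin x / h"
    using sin_ge_half[OF x] assms by (intro divide_right_mono mult_left_mono) auto
  finally have "(real m / L * 1.5)\<^sup>2 \<le> (2 * sin x / h)\<^sup>2"
    using assms by (intro power_mono) auto
  moreover have "(real m / L * 1.5)\<^sup>2 = 9 / 4 * ((real m)\<^sup>2 / L\<^sup>2)"
    by (simp add: power2_eq_square)
  moreover have "(real m)\<^sup>2 / L\<^sup>2 \<ge> 0" by simp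
  ultimately have "2 * ((real m)\<^sup>2 / L\<^sup>2) \<le> (2 * sin x / h)\<^sup>2" by linarith
  then show "diff_eig h N m \<ge> 2 * (real m)\<^sup>2 / L\<^sup>2" by (simp add: diff_eig_def x_def)
  have "(sin x)\<^sup>2 \<le> 1" by (simp add: abs_square_le_1)
  then show "diff_eig h N m \<le> 4 / h\<^sup>2"
    unfolding diff_eig_def x_def[symmetric] power_divide
    by (intro divide_right_mono) (auto simp: power_mult_distrib)
  show "diff_eig h N m \<ge> 0" by (simp add: diff_eig_def)
qed

text \<open>The negative mixed term does not destroy ellipticity: both one-dimensional eigenvalues
  are at most \<open>4 / h\<^sup>2\<close>, so \<open>\<alpha>\<^sub>2\<close>, which is about \<open>h\<^sup>2 / 6\<close>, times their product is at most about one third of their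
  sum.\<close>

lemma scheme_eig_ge:
  assumes h: "h > 0" "real N * h = L" "\<bar>K * h\<bar> \<le> 1" and m: "m \<in> {1..<N}" and n: "n \<in> {1..<N}"
  shows "scheme_eig K h N m n \<ge> 5 / 4 * ((real m)\<^sup>2 + (real n)\<^sup>2) / L\<^sup>2 - K\<^sup>2"
proof -
  note bm = diff_eig_bounds[OF h(1,2) m] and bn = diff_eig_bounds[OF h(1,2) n]
  define x y where "x = diff_eig h N m" and "y = diff_eig h N n"
  define k where "k = K\<^sup>2 * h\<^sup>2"
  have k: "0 \<le> k" "k \<le> 1"
    using h(3) by (simp_all add: k_def power_mult_distrib[symmetric] abs_square_le_1)
  have kk: "0 \<le> k\<^sup>2" "k\<^sup>2 \<le> k"  "0 \<le> k ^ 3"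
    using k by (simp_all add: power2_eq_square mult_left_le)
  have e: "K ^ 4 * h ^ 4 = k\<^sup>2" "K ^ 6 * h ^ 6 = k ^ 3"
    by (simp_all add: k_def power_mult_distrib power_mult[symmetric])
  have a1: "\<alpha>1 K h \<ge> 1" and a3: "\<alpha>3 K h \<le> 1"
    using k kk unfolding \<alpha>1_def \<alpha>3_def e k_def[symmetric] by (simp, linarith)
  have a2: "\<alpha>2 K h \<le> h\<^sup>2 / 6 * (21 / 20)"
    unfolding \<alpha>2_def e k_def[symmetric] using k kk by (intro mult_left_mono) (linarith, simp)
  have hx: "h\<^sup>2 * x \<le> 4" "h\<^sup>2 * y \<le> 4" "0 \<le> x" "0 \<le> y"
    using bm bn h by (simp_all add: x_def y_def field_simps)
  have "h\<^sup>2 * x * y \<le> 4 * y" "h\<^sup>2 * y * x \<le> 4 * x"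
    using hx by (intro mult_right_mono; simp)+
  then have hxy: "h\<^sup>2 * (x * y) \<le> 2 * (x + y)" by (simp add: mult_ac)
  have "\<alpha>2 K h * (x * y) \<le> h\<^sup>2 / 6 * (21 / 20) * (x * y)"
    using a2 hx by (intro mult_right_mono) auto
  also have "\<dots> = 7 / 40 * (h\<^sup>2 * (x * y))" by simp
  also have "\<dots> \<le> (7 / 20) * (x + y)" using hxy by linarith
  finally have t2: "\<alpha>2 K h * x * y \<le> (7 / 20) * (x + y)" by (simp add: mult_ac)
  have t1: "1 * (x + y) \<le> \<alpha>1 K h * (x + y)" using a1 hx by (intro mult_right_mono) auto
  have t3: "K\<^sup>2 * \<alpha>3 K h \<le> K\<^sup>2 * 1" using a3 by (intro mult_left_mono) auto
  have eig: "scheme_eig K h N m n \<ge> (13 / 20) * (x + y) - K\<^sup>2"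
    using t1 t2 t3 unfolding scheme_eig_def x_def[symmetric] y_def[symmetric] by linarith
  define w where "w = ((real m)\<^sup>2 + (real n)\<^sup>2) / L\<^sup>2"
  have "x + y \<ge> 2 * w"
    using bm(1) bn(1) by (simp add: x_def y_def w_def add_divide_distrib)
  moreover have "w \<ge> 0" by (simp add: w_def)
  ultimately have "5 / 4 * w \<le> 13 / 20 * (x + y)" by simp
  with eig have "scheme_eig K h N m n \<ge> 5 / 4 * w - K\<^sup>2" by linarith
  then show ?thesis by (simp add: w_def)
qed

text \<open>Here \<open>\<pi> m / (2 N)\<close> is written as \<open>\<pi> m h / (2 L)\<close>, so that the eigenvalue becomes a function of the real
  variable \<open>h\<close> and its limit at \<open>0\<close> makes sense.\<close>

lemma scheme_eig_tendsto:
  assumes "L > 0"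
  defines "d \<equiv> \<lambda>m h. (2 * sin (pi * real m * h / (2 * L)) / h)\<^sup>2"
  shows "((\<lambda>h. \<alpha>1 K h * (d m h + d n h) - \<alpha>2 K h * d m h * d n h - K\<^sup>2 * \<alpha>3 K h)
     \<longlongrightarrow> (pi / L)\<^sup>2 * ((real m)\<^sup>2 + (real n)\<^sup>2) - K\<^sup>2) (at_right 0)"
proof -
  have d: "(d m \<longlongrightarrow> (pi / L * real m)\<^sup>2) (at_right 0)" for m
  proof -
    have "((\<lambda>h. 2 * sin (c * h) / h) \<longlongrightarrow> 2 * c) (at_right 0)" for c :: real
      by real_asymp
    from tendsto_power[OF this[of "pi * real m / (2 * L)"], of 2] show ?thesis
      using assms by (simp add: d_def mult_ac)
  qed
  have a: "(\<alpha>1 K \<longlongrightarrow> 1) (at_right 0)" "(\<alpha>2 K \<longlongrightarrow> 0) (at_right 0)" "(\<alpha>3 K \<longlongrightarrow> 1) (at_right 0)"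
    unfolding \<alpha>1_def \<alpha>2_def \<alpha>3_def by real_asymp+
  have "((\<lambda>h. \<alpha>1 K h * (d m h + d n h) - \<alpha>2 K h * d m h * d n h - K\<^sup>2 * \<alpha>3 K h)
     \<longlongrightarrow> 1 * ((pi / L * real m)\<^sup>2 + (pi / L * real n)\<^sup>2) - 0 * (pi / L * real m)\<^sup>2 * (pi / L * real n)\<^sup>2 - K\<^sup>2 * 1) (at_right 0)"
    by (intro tendsto_intros a d)
  then show ?thesis by (simp add: power_mult_distrib power_divide distrib_left)
qed

text \<open>Outside the finite set \<open>low\<close> the bound of \<open>scheme_eig_ge\<close> suffices.  On \<open>low\<close> each eigenvalue
  converges to a nonzero number as \<open>h\<close> tends to \<open>0\<close>, so for small \<open>h\<close> it keeps at least half of its limit.\<close>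

lemma scheme_eig_bounded_below:
  assumes L: "L > 0"
    and nonres: "\<And>m n :: nat. m \<ge> 1 \<Longrightarrow> n \<ge> 1 \<Longrightarrow> K\<^sup>2 \<noteq> (pi / L)\<^sup>2 * ((real m)\<^sup>2 + (real n)\<^sup>2)"
  obtains h0 c where "h0 > 0" "c > 0"
    "\<And>N h m n. h > 0 \<Longrightarrow> h < h0 \<Longrightarrow> real N * h = L \<Longrightarrow> m \<in> {1..<N} \<Longrightarrow> n \<in> {1..<N} \<Longrightarrow>
        \<bar>scheme_eig K h N m n\<bar> \<ge> c * ((real m)\<^sup>2 + (real n)\<^sup>2)"
proof -
  define q where "q = (\<lambda>p :: nat \<times> nat. (real (fst p))\<^sup>2 + (real (snd p))\<^sup>2)"
  define \<mu> where "\<mu> = (\<lambda>p. (pi / L)\<^sup>2 * q p - K\<^sup>2)"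
  define E where "E = (\<lambda>h p. let d = \<lambda>m. (2 * sin (pi * real m * h / (2 * L)) / h)\<^sup>2 in
     \<alpha>1 K h * (d (fst p) + d (snd p)) - \<alpha>2 K h * d (fst p) * d (snd p) - K\<^sup>2 * \<alpha>3 K h)"
  define low where "low = {p. fst p \<ge> 1 \<and> snd p \<ge> 1 \<and> q p \<le> 4 * K\<^sup>2 * L\<^sup>2}"
  have "low \<subseteq> {.. nat \<lceil>4 * K\<^sup>2 * L\<^sup>2\<rceil>} \<times> {.. nat \<lceil>4 * K\<^sup>2 * L\<^sup>2\<rceil>}"
  proof
    fix p assume p: "p \<in> low"
    have "real (fst p) \<le> (real (fst p))\<^sup>2" "real (snd p) \<le> (real (snd p))\<^sup>2"
      using p by (auto simp: low_def power2_eq_square)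
    moreover have "(real (fst p))\<^sup>2 \<le> q p" "(real (snd p))\<^sup>2 \<le> q p" by (auto simp: q_def)
    moreover have "q p \<le> 4 * K\<^sup>2 * L\<^sup>2" using p by (simp add: low_def)
    ultimately have "real (fst p) \<le> 4 * K\<^sup>2 * L\<^sup>2" "real (snd p) \<le> 4 * K\<^sup>2 * L\<^sup>2" by linarith+
    then show "p \<in> {.. nat \<lceil>4 * K\<^sup>2 * L\<^sup>2\<rceil>} \<times> {.. nat \<lceil>4 * K\<^sup>2 * L\<^sup>2\<rceil>}"
      by (cases p) (auto simp: le_nat_iff le_ceiling_iff intro: order_trans[OF _ le_of_int_ceiling] ; linarith)
  qed
  then have fin: "finite low" by (rule finite_subset) auto
  have qpos: "q p > 0" if "p \<in> low" for p
    using that by (auto simp: low_def q_def intro: add_pos_pos)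
  have \<mu>0: "\<bar>\<mu> p\<bar> > 0" if "p \<in> low" for p
    using that nonres[of "fst p" "snd p"] by (auto simp: low_def q_def \<mu>_def)
  have "\<forall>\<^sub>F h in at_right 0. \<bar>E h p\<bar> \<ge> \<bar>\<mu> p\<bar> / 2" if "p \<in> low" for p
  proof -
    have "((\<lambda>h. E h p) \<longlongrightarrow> \<mu> p) (at_right 0)"
      unfolding E_def \<mu>_def q_def Let_def by (rule scheme_eig_tendsto[OF L])
    then have "((\<lambda>h. \<bar>E h p\<bar>) \<longlongrightarrow> \<bar>\<mu> p\<bar>) (at_right 0)" by (rule tendsto_rabs)
    from order_tendstoD(1)[OF this, of "\<bar>\<mu> p\<bar> / 2"] \<mu>0[OF that]
    have "\<forall>\<^sub>F h in at_right 0. \<bar>\<mu> p\<bar> / 2 < \<bar>E h p\<bar>" by simp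
    then show ?thesis by (rule eventually_mono) simp
  qed
  then have "\<forall>\<^sub>F h in at_right 0. \<forall>p\<in>low. \<bar>E h p\<bar> \<ge> \<bar>\<mu> p\<bar> / 2"
    using fin by (simp add: eventually_ball_finite_distrib)
  then obtain h1 where h1: "h1 > 0" "\<And>h p. h > 0 \<Longrightarrow> h < h1 \<Longrightarrow> p \<in> low \<Longrightarrow> \<bar>E h p\<bar> \<ge> \<bar>\<mu> p\<bar> / 2"
    unfolding eventually_at_right_field by blast
  \<comment> \<open>The constant \<open>1 / L\<^sup>2\<close> serves the indices outside \<open>low\<close>.\<close>
  define c where "c = Min (insert (1 / L\<^sup>2) ((\<lambda>p. \<bar>\<mu> p\<bar> / 2 / q p) ` low))"
  have cpos: "c > 0"
    unfolding c_def using fin L \<mu>0 qpos by (subst Min_gr_iff) auto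
  have c1: "c \<le> 1 / L\<^sup>2" and c2: "\<And>p. p \<in> low \<Longrightarrow> c \<le> \<bar>\<mu> p\<bar> / 2 / q p"
    unfolding c_def using fin by (auto intro: Min_le)
  show ?thesis
  proof
    show "min h1 (1 / (\<bar>K\<bar> + 1)) > 0" using h1(1) by simp
    show "c > 0" by (rule cpos)
  next
    fix N h m n assume h: "h > 0" "h < min h1 (1 / (\<bar>K\<bar> + 1))" "real N * h = L"
      and m: "m \<in> {1..<N}" and n: "n \<in> {1..<N}"
    show "\<bar>scheme_eig K h N m n\<bar> \<ge> c * ((real m)\<^sup>2 + (real n)\<^sup>2)"
    proof (cases "(m, n) \<in> low")
      case True
      have arg: "pi * real l / (2 * real N) = pi * real l * h / (2 * L)" for l
        using h by (auto simp: field_simps)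
      have "c * q (m, n) \<le> \<bar>\<mu> (m, n)\<bar> / 2"
        using c2[OF True] qpos[OF True] by (simp add: pos_le_divide_eq)
      also have "\<dots> \<le> \<bar>E h (m, n)\<bar>" using h True by (intro h1) auto
      also have "E h (m, n) = scheme_eig K h N m n"
        by (simp add: E_def scheme_eig_def diff_eig_def Let_def arg)
      finally show ?thesis by (simp add: q_def)
    next
      case False
      define Q where "Q = (real m)\<^sup>2 + (real n)\<^sup>2"
      have "Q > 4 * K\<^sup>2 * L\<^sup>2"
        using False m n by (auto simp: low_def q_def Q_def)
      then have K2: "K\<^sup>2 \<le> 1 / 4 * (Q / L\<^sup>2)" using L by (simp add: field_simps)
      have "\<bar>K\<bar> * h \<le> (\<bar>K\<bar> + 1) * (1 / (\<bar>K\<bar> + 1))"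
        using h by (intro mult_mono) auto
      also have "\<dots> = 1" by (simp add: add_nonneg_eq_0_iff)
      finally have "\<bar>K * h\<bar> \<le> 1" using h by (simp add: abs_mult)
      from scheme_eig_ge[OF h(1,3) this m n] have "scheme_eig K h N m n \<ge> 5 / 4 * (Q / L\<^sup>2) - K\<^sup>2"
        by (simp add: Q_def)
      moreover have "c * Q \<le> 1 / L\<^sup>2 * Q" using c1 by (intro mult_right_mono) (auto simp: Q_def)
      ultimately show ?thesis using K2 unfolding Q_def[symmetric] by simp
    qed
  qed
qed

section \<open>Partial derivatives on a closed rectangle\<close>

lemma C_k_on_continuous: "C_k_on k I J u \<Longrightarrow> continuous_on (I \<times> J) u"
  by (cases k) auto

lemma C_k_on_mono: "C_k_on k I J u \<Longrightarrow> j \<le> k \<Longrightarrow> C_k_on j I J u"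
proof (induction k arbitrary: j u)
  case (Suc k)
  then show ?case by (cases j) auto
qed auto

lemma C_k_on_dx_iter: "C_k_on (m + k) I J u \<Longrightarrow> C_k_on k I J ((dx I ^^ m) u)"
  by (induction m arbitrary: u) (auto simp: funpow_swap1)

lemma C_k_on_dy_iter: "C_k_on (m + k) I J u \<Longrightarrow> C_k_on k I J ((dy J ^^ m) u)"
  by (induction m arbitrary: u) (auto simp: funpow_swap1)

lemma has_dx:
  assumes "C_k_on (Suc k) I J u" "x \<in> I" "y \<in> J"
  shows "((\<lambda>t. u (t, y)) has_real_derivative dx I u (x, y)) (at x within I)"
  using assms by (simp add: dx_def has_real_derivative_iff_has_vector_derivative vector_derivative_works)

lemma has_dy:
  assumes "C_k_on (Suc k) I J u" "x \<in> I" "y \<in> J"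
  shows "((\<lambda>t. u (x, t)) has_real_derivative dy J u (x, y)) (at y within J)"
  using assms by (simp add: dy_def has_real_derivative_iff_has_vector_derivative vector_derivative_works)

lemma dx_cong:
  assumes "\<And>t. t \<in> I \<Longrightarrow> u (t, y) = v (t, y)" "x \<in> I"
  shows "dx I u (x, y) = dx I v (x, y)"
proof -
  have "((\<lambda>t. u (t, y)) has_vector_derivative D) (at x within I)
    \<longleftrightarrow> ((\<lambda>t. v (t, y)) has_vector_derivative D) (at x within I)" for D
    using has_vector_derivative_transform[OF assms(2), of "\<lambda>t. v (t, y)" "\<lambda>t. u (t, y)"]
      has_vector_derivative_transform[OF assms(2), of "\<lambda>t. u (t, y)" "\<lambda>t. v (t, y)"] assms(1) by auto
  then show ?thesis by (simp add: dx_def vector_derivative_def)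
qed

lemma dy_cong:
  assumes "\<And>t. t \<in> J \<Longrightarrow> u (x, t) = v (x, t)" "y \<in> J"
  shows "dy J u (x, y) = dy J v (x, y)"
proof -
  have "((\<lambda>t. u (x, t)) has_vector_derivative D) (at y within J)
    \<longleftrightarrow> ((\<lambda>t. v (x, t)) has_vector_derivative D) (at y within J)" for D
    using has_vector_derivative_transform[OF assms(2), of "\<lambda>t. v (x, t)" "\<lambda>t. u (x, t)"]
      has_vector_derivative_transform[OF assms(2), of "\<lambda>t. u (x, t)" "\<lambda>t. v (x, t)"] assms(1) by auto
  then show ?thesis by (simp add: dy_def vector_derivative_def)
qed

lemma dx_iter_cong:
  assumes "\<forall>p\<in>I \<times> J. u p = v p"
  shows "\<forall>p\<in>I \<times> J. (dx I ^^ m) u p = (dx I ^^ m) v p"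
  by (induction m) (use assms in \<open>auto intro: dx_cong\<close>)

lemma dy_iter_cong:
  assumes "\<forall>p\<in>I \<times> J. u p = v p"
  shows "\<forall>p\<in>I \<times> J. (dy J ^^ m) u p = (dy J ^^ m) v p"
  by (induction m) (use assms in \<open>auto intro: dy_cong\<close>)

lemma differentiable_transform_on:
  assumes "f differentiable (at x within S)" "x \<in> S" "\<And>t. t \<in> S \<Longrightarrow> g t = f t"
  shows "g differentiable (at x within S)"
  using assms has_derivative_transform unfolding differentiable_def by blast

lemma C_k_on_cong:
  assumes "C_k_on k I J u" "\<forall>p\<in>I \<times> J. u p = v p"
  shows "C_k_on k I J v"
  using assms
proof (induction k arbitrary: u v)
  case 0
  then show ?case using continuous_on_cong[of "I \<times> J" "I \<times> J" u v] by (simp only: C_k_on.simps)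
next
  case (Suc k)
  note u = Suc.prems(1)[unfolded C_k_on.simps] and eq = Suc.prems(2)
  have "(\<lambda>t. v (t, y)) differentiable (at x within I)"
    "(\<lambda>t. v (x, t)) differentiable (at y within J)" if x: "x \<in> I" and y: "y \<in> J" for x y
  proof -
    have *: "(\<lambda>t. u (t, y)) differentiable (at x within I)" "(\<lambda>t. u (x, t)) differentiable (at y within J)"
      using u x y by blast+
    show "(\<lambda>t. v (t, y)) differentiable (at x within I)"
      by (rule differentiable_transform_on[OF *(1) x]) (use eq y in simp)
    show "(\<lambda>t. v (x, t)) differentiable (at y within J)"
      by (rule differentiable_transform_on[OF *(2) y]) (use eq x in simp)
  qed
  moreover have "continuous_on (I \<times> J) v"
    using u eq continuous_on_cong[of "I \<times> J" "I \<times> J" u v] by blast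
  moreover have "C_k_on k I J (dx I v)"
    by (rule Suc.IH[of "dx I u"]) (use u dx_iter_cong[OF eq, of 1] in simp_all)
  moreover have "C_k_on k I J (dy J v)"
    by (rule Suc.IH[of "dy J u"]) (use u dy_iter_cong[OF eq, of 1] in simp_all)
  ultimately show ?case unfolding C_k_on.simps by blast
qed

lemma mvt_within:
  fixes g :: "real \<Rightarrow> real"
  assumes "s < t" "{s..t} \<subseteq> S"
    and deriv: "\<And>x. x \<in> {s..t} \<Longrightarrow> (g has_real_derivative g' x) (at x within S)"
  obtains x where "x \<in> {s..t}" "g t - g s = (t - s) * g' x"
proof -
  have "\<exists>x\<in>{s<..<t}. g t - g s = g' x * (t - s)"
  proof (rule mvt_simple[OF assms(1)])
    fix x assume "s \<le> x" "x \<le> t"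
    then have "(g has_real_derivative g' x) (at x within {s..t})"
      using deriv[of x] assms(2) has_field_derivative_subset by auto
    then show "(g has_derivative (*) (g' x)) (at x within {s..t})"
      by (rule has_field_derivative_imp_has_derivative)
  qed
  then obtain x where "x \<in> {s<..<t}" "g t - g s = g' x * (t - s)" ..
  then show thesis by (intro that[of x]) auto
qed

text \<open>The mean value theorem, first in \<open>x\<close> for the difference of \<open>u\<close> along the two horizontal sides, then in
  \<open>y\<close> for \<open>\<partial>\<^sub>x u\<close>.\<close>

lemma rectangle_increment_dy_dx:
  assumes "C_k_on 2 {a..b} {c..d} u" "a \<le> x1" "x1 < x2" "x2 \<le> b" "c \<le> y1" "y1 < y2" "y2 \<le> d"
  obtains p where "p \<in> {x1..x2} \<times> {y1..y2}"
    "u (x2, y2) - u (x1, y2) - u (x2, y1) + u (x1, y1) = (x2 - x1) * ((y2 - y1) * dy {c..d} (dx {a..b} u) p)"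
proof -
  let ?ux = "dx {a..b} u"
  have C: "C_k_on (Suc 1) {a..b} {c..d} u" "C_k_on (Suc 0) {a..b} {c..d} ?ux"
    using assms(1) by (simp_all add: numeral_2_eq_2)
  have sub: "{x1..x2} \<subseteq> {a..b}" "{y1..y2} \<subseteq> {c..d}" using assms by auto
  have y: "y1 \<in> {c..d}" "y2 \<in> {c..d}" using assms by auto
  have "((\<lambda>t. u (t, y2) - u (t, y1)) has_real_derivative ?ux (t, y2) - ?ux (t, y1)) (at t within {a..b})"
    if "t \<in> {x1..x2}" for t
    using that sub(1) y by (intro DERIV_diff has_dx[OF C(1)]) blast+
  from mvt_within[OF assms(3) sub(1) this] obtain x where x: "x \<in> {x1..x2}"
    "(u (x2, y2) - u (x2, y1)) - (u (x1, y2) - u (x1, y1)) = (x2 - x1) * (?ux (x, y2) - ?ux (x, y1))" .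
  have "((\<lambda>t. ?ux (x, t)) has_real_derivative dy {c..d} ?ux (x, t)) (at t within {c..d})"
    if "t \<in> {y1..y2}" for t
    using that sub x(1) by (intro has_dy[OF C(2)]) blast+
  from mvt_within[OF assms(6) sub(2) this] obtain y where y: "y \<in> {y1..y2}"
    "?ux (x, y2) - ?ux (x, y1) = (y2 - y1) * dy {c..d} ?ux (x, y)" .
  show thesis
    by (rule that[of "(x, y)"]) (use x y in simp_all)
qed

lemma rectangle_increment_dx_dy:
  assumes "C_k_on 2 {a..b} {c..d} u" "a \<le> x1" "x1 < x2" "x2 \<le> b" "c \<le> y1" "y1 < y2" "y2 \<le> d"
  obtains p where "p \<in> {x1..x2} \<times> {y1..y2}"
    "u (x2, y2) - u (x1, y2) - u (x2, y1) + u (x1, y1) = (x2 - x1) * ((y2 - y1) * dx {a..b} (dy {c..d} u) p)"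
proof -
  let ?uy = "dy {c..d} u"
  have C: "C_k_on (Suc 1) {a..b} {c..d} u" "C_k_on (Suc 0) {a..b} {c..d} ?uy"
    using assms(1) by (simp_all add: numeral_2_eq_2)
  have sub: "{x1..x2} \<subseteq> {a..b}" "{y1..y2} \<subseteq> {c..d}" using assms by auto
  have x: "x1 \<in> {a..b}" "x2 \<in> {a..b}" using assms by auto
  have "((\<lambda>t. u (x2, t) - u (x1, t)) has_real_derivative ?uy (x2, t) - ?uy (x1, t)) (at t within {c..d})"
    if "t \<in> {y1..y2}" for t
    using that sub(2) x by (intro DERIV_diff has_dy[OF C(1)]) blast+
  from mvt_within[OF assms(6) sub(2) this] obtain y where y: "y \<in> {y1..y2}"
    "(u (x2, y2) - u (x1, y2)) - (u (x2, y1) - u (x1, y1)) = (y2 - y1) * (?uy (x2, y) - ?uy (x1, y))" .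
  have "((\<lambda>t. ?uy (t, y)) has_real_derivative dx {a..b} ?uy (t, y)) (at t within {a..b})"
    if "t \<in> {x1..x2}" for t
    using that sub y(1) by (intro has_dx[OF C(2)]) blast+
  from mvt_within[OF assms(3) sub(1) this] obtain x where x: "x \<in> {x1..x2}"
    "?uy (x2, y) - ?uy (x1, y) = (x2 - x1) * dx {a..b} ?uy (x, y)" .
  show thesis
    by (rule that[of "(x, y)"]) (use x y in \<open>simp_all add: mult.left_commute\<close>)
qed

locale rectangle =
  fixes a b c d :: real
  assumes ab: "a < b" and cd: "c < d"
begin

abbreviation R :: "(real \<times> real) set" where "R \<equiv> {a..b} \<times> {c..d}"
abbreviation Ck :: "nat \<Rightarrow> (real \<times> real \<Rightarrow> real) \<Rightarrow> bool" where "Ck k \<equiv> C_k_on k {a..b} {c..d}"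
abbreviation Dx :: "(real \<times> real \<Rightarrow> real) \<Rightarrow> real \<times> real \<Rightarrow> real" where "Dx \<equiv> dx {a..b}"
abbreviation Dy :: "(real \<times> real \<Rightarrow> real) \<Rightarrow> real \<times> real \<Rightarrow> real" where "Dy \<equiv> dy {c..d}"

lemma dx_eqI:
  assumes "((\<lambda>t. u (t, y)) has_real_derivative D) (at x within {a..b})" "x \<in> {a..b}"
  shows "Dx u (x, y) = D"
  using assms vector_derivative_within_closed_interval[OF ab, of x "\<lambda>t. u (t, y)" D]
  by (simp add: dx_def has_real_derivative_iff_has_vector_derivative)

lemma dy_eqI:
  assumes "((\<lambda>t. u (x, t)) has_real_derivative D) (at y within {c..d})" "y \<in> {c..d}"
  shows "Dy u (x, y) = D"
  using assms vector_derivative_within_closed_interval[OF cd, of y "\<lambda>t. u (x, t)" D]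
  by (simp add: dy_def has_real_derivative_iff_has_vector_derivative)

lemma dx_lincomb:
  assumes "Ck (Suc k) u" "Ck (Suc k) v" "p \<in> R"
  shows "Dx (\<lambda>p. \<alpha> * u p + \<beta> * v p) p = \<alpha> * Dx u p + \<beta> * Dx v p"
proof -
  obtain x y where p: "p = (x, y)" and x: "x \<in> {a..b}" and y: "y \<in> {c..d}" using assms(3) by auto
  have "((\<lambda>t. \<alpha> * u (t, y) + \<beta> * v (t, y)) has_real_derivative \<alpha> * Dx u (x, y) + \<beta> * Dx v (x, y))
      (at x within {a..b})"
    by (intro DERIV_add DERIV_cmult has_dx[OF assms(1) x y] has_dx[OF assms(2) x y])
  then show ?thesis unfolding p using x by (rule dx_eqI)
qed

lemma dy_lincomb:
  assumes "Ck (Suc k) u" "Ck (Suc k) v" "p \<in> R"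
  shows "Dy (\<lambda>p. \<alpha> * u p + \<beta> * v p) p = \<alpha> * Dy u p + \<beta> * Dy v p"
proof -
  obtain x y where p: "p = (x, y)" and x: "x \<in> {a..b}" and y: "y \<in> {c..d}" using assms(3) by auto
  have "((\<lambda>t. \<alpha> * u (x, t) + \<beta> * v (x, t)) has_real_derivative \<alpha> * Dy u (x, y) + \<beta> * Dy v (x, y))
      (at y within {c..d})"
    by (intro DERIV_add DERIV_cmult has_dy[OF assms(1) x y] has_dy[OF assms(2) x y])
  then show ?thesis unfolding p using y by (rule dy_eqI)
qed

lemma C_k_on_lincomb:
  assumes "Ck k u" "Ck k v"
  shows "Ck k (\<lambda>p. \<alpha> * u p + \<beta> * v p)"
  using assms
proof (induction k arbitrary: u v)
  case 0
  then show ?case by (simp add: continuous_intros)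
next
  case (Suc k)
  note u = Suc.prems(1) and v = Suc.prems(2)
  have "(\<lambda>t. \<alpha> * u (t, y) + \<beta> * v (t, y)) differentiable (at x within {a..b})"
       "(\<lambda>t. \<alpha> * u (x, t) + \<beta> * v (x, t)) differentiable (at y within {c..d})"
    if "x \<in> {a..b}" "y \<in> {c..d}" for x y
    using u v that by (intro differentiable_add differentiable_mult differentiable_const; simp)+
  moreover have "continuous_on R (\<lambda>p. \<alpha> * u p + \<beta> * v p)"
    by (intro continuous_on_add continuous_on_mult_left C_k_on_continuous[OF u] C_k_on_continuous[OF v])
  moreover have "Ck k (Dx (\<lambda>p. \<alpha> * u p + \<beta> * v p))"
  proof (rule C_k_on_cong)
    show "Ck k (\<lambda>p. \<alpha> * Dx u p + \<beta> * Dx v p)" by (rule Suc.IH) (use u v in simp_all)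
    show "\<forall>p\<in>R. \<alpha> * Dx u p + \<beta> * Dx v p = Dx (\<lambda>p. \<alpha> * u p + \<beta> * v p) p"
      by (intro ballI sym[OF dx_lincomb[OF u v]])
  qed
  moreover have "Ck k (Dy (\<lambda>p. \<alpha> * u p + \<beta> * v p))"
  proof (rule C_k_on_cong)
    show "Ck k (\<lambda>p. \<alpha> * Dy u p + \<beta> * Dy v p)" by (rule Suc.IH) (use u v in simp_all)
    show "\<forall>p\<in>R. \<alpha> * Dy u p + \<beta> * Dy v p = Dy (\<lambda>p. \<alpha> * u p + \<beta> * v p) p"
      by (intro ballI sym[OF dy_lincomb[OF u v]])
  qed
  ultimately show ?case by (simp only: C_k_on.simps) blast
qed

lemma dx_iter_lincomb:
  assumes "Ck m u" "Ck m v"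
  shows "\<forall>p\<in>R. (Dx ^^ m) (\<lambda>p. \<alpha> * u p + \<beta> * v p) p = \<alpha> * (Dx ^^ m) u p + \<beta> * (Dx ^^ m) v p"
  using assms
proof (induction m arbitrary: u v)
  case (Suc m)
  have "\<forall>p\<in>R. (Dx ^^ m) (Dx (\<lambda>p. \<alpha> * u p + \<beta> * v p)) p
      = (Dx ^^ m) (\<lambda>p. \<alpha> * Dx u p + \<beta> * Dx v p) p"
    by (intro dx_iter_cong ballI dx_lincomb[OF Suc.prems])
  moreover have "\<forall>p\<in>R. (Dx ^^ m) (\<lambda>p. \<alpha> * Dx u p + \<beta> * Dx v p) p
      = \<alpha> * (Dx ^^ m) (Dx u) p + \<beta> * (Dx ^^ m) (Dx v) p"
    using Suc.prems by (intro Suc.IH) simp_all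
  ultimately show ?case by (simp only: funpow_Suc_right o_apply) simp
qed simp

lemma dy_iter_lincomb:
  assumes "Ck m u" "Ck m v"
  shows "\<forall>p\<in>R. (Dy ^^ m) (\<lambda>p. \<alpha> * u p + \<beta> * v p) p = \<alpha> * (Dy ^^ m) u p + \<beta> * (Dy ^^ m) v p"
  using assms
proof (induction m arbitrary: u v)
  case (Suc m)
  have "\<forall>p\<in>R. (Dy ^^ m) (Dy (\<lambda>p. \<alpha> * u p + \<beta> * v p)) p
      = (Dy ^^ m) (\<lambda>p. \<alpha> * Dy u p + \<beta> * Dy v p) p"
    by (intro dy_iter_cong ballI dy_lincomb[OF Suc.prems])
  moreover have "\<forall>p\<in>R. (Dy ^^ m) (\<lambda>p. \<alpha> * Dy u p + \<beta> * Dy v p) p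
      = \<alpha> * (Dy ^^ m) (Dy u) p + \<beta> * (Dy ^^ m) (Dy v) p"
    using Suc.prems by (intro Suc.IH) simp_all
  ultimately show ?case by (simp only: funpow_Suc_right o_apply) simp
qed simp

text \<open>Schwarz's theorem up to the boundary.  The increment of \<open>u\<close> over a small rectangle is its area times
  a value of either mixed derivative.  The small rectangle is a neighbourhood of \<open>p\<close>
  clipped to \<open>R\<close>, which still has positive area when \<open>p\<close> lies on the boundary.\<close>

lemma mixed_partials_commute:
  assumes u: "Ck 2 u" and p: "p \<in> R"
  shows "Dx (Dy u) p = Dy (Dx u) p"
proof (rule ccontr)
  let ?F = "Dx (Dy u)" and ?G = "Dy (Dx u)"
  assume neq: "?F p \<noteq> ?G p"
  define e where "e = \<bar>?F p - ?G p\<bar> / 2"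
  have e: "e > 0" using neq by (simp add: e_def)
  have cont: "continuous_on R ?F" "continuous_on R ?G"
    using u by (simp_all add: numeral_2_eq_2)
  obtain r1 where r1: "r1 > 0" "\<And>q. q \<in> R \<Longrightarrow> dist q p < r1 \<Longrightarrow> dist (?F q) (?F p) < e"
    using cont(1) p e unfolding continuous_on_iff by metis
  obtain r2 where r2: "r2 > 0" "\<And>q. q \<in> R \<Longrightarrow> dist q p < r2 \<Longrightarrow> dist (?G q) (?G p) < e"
    using cont(2) p e unfolding continuous_on_iff by metis
  define r where "r = min r1 r2 / 3"
  have r: "r > 0" "3 * r \<le> r1" "3 * r \<le> r2" using r1(1) r2(1) by (auto simp: r_def)
  obtain x y where xy: "p = (x, y)" "a \<le> x" "x \<le> b" "c \<le> y" "y \<le> d" using p by auto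
  define x1 x2 y1 y2 where "x1 = max a (x - r)" and "x2 = min b (x + r)" and "y1 = max c (y - r)" and "y2 = min d (y + r)"
  have bounds: "a \<le> x1" "x1 < x2" "x2 \<le> b" "c \<le> y1" "y1 < y2" "y2 \<le> d"
    using xy r ab cd by (auto simp: x1_def x2_def y1_def y2_def)
  have near: "dist q p < r1 \<and> dist q p < r2 \<and> q \<in> R" if q: "q \<in> {x1..x2} \<times> {y1..y2}" for q
  proof -
    obtain s t where st: "q = (s, t)" by (cases q)
    have "dist q p \<le> \<bar>s - x\<bar> + \<bar>t - y\<bar>"
      unfolding st xy dist_norm by (metis diff_Pair norm_Pair_le real_norm_def)
    also have "\<dots> \<le> 2 * r" using q st by (auto simp: x1_def x2_def y1_def y2_def)
    also have "\<dots> < 3 * r" using r by simp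
    finally show ?thesis using r q bounds by auto
  qed
  obtain q1 where q1: "q1 \<in> {x1..x2} \<times> {y1..y2}"
    "u (x2, y2) - u (x1, y2) - u (x2, y1) + u (x1, y1) = (x2 - x1) * ((y2 - y1) * ?G q1)"
    by (rule rectangle_increment_dy_dx[OF u bounds])
  obtain q2 where q2: "q2 \<in> {x1..x2} \<times> {y1..y2}"
    "u (x2, y2) - u (x1, y2) - u (x2, y1) + u (x1, y1) = (x2 - x1) * ((y2 - y1) * ?F q2)"
    by (rule rectangle_increment_dx_dy[OF u bounds])
  have "(x2 - x1) * ((y2 - y1) * ?G q1) = (x2 - x1) * ((y2 - y1) * ?F q2)"
    by (rule trans[OF sym[OF q1(2)] q2(2)])
  then have "?G q1 = ?F q2"
    unfolding mult_cancel_left using bounds by simp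
  moreover have "\<bar>?F q2 - ?F p\<bar> < e" using r1(2)[of q2] near[OF q2(1)] by (simp add: dist_real_def)
  moreover have "\<bar>?G q1 - ?G p\<bar> < e" using r2(2)[of q1] near[OF q1(1)] by (simp add: dist_real_def)
  ultimately have "\<bar>?F p - ?G p\<bar> < e + e" by linarith
  then show False by (simp add: e_def)
qed

lemma dx_dy_iter_commute:
  assumes "Ck (Suc n) u"
  shows "\<forall>p\<in>R. Dx ((Dy ^^ n) u) p = (Dy ^^ n) (Dx u) p"
  using assms
proof (induction n)
  case (Suc n)
  have u: "Ck 2 ((Dy ^^ n) u)" using Suc.prems by (intro C_k_on_dy_iter) (simp add: add.commute)
  have "\<forall>p\<in>R. Dx ((Dy ^^ n) u) p = (Dy ^^ n) (Dx u) p"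
    by (intro Suc.IH C_k_on_mono[OF Suc.prems]) simp
  from dy_iter_cong[OF this, of 1] show ?case
    using mixed_partials_commute[OF u] by simp
qed simp

lemma dx_iter_dy_iter_commute:
  assumes "Ck (m + n) u"
  shows "\<forall>p\<in>R. (Dx ^^ m) ((Dy ^^ n) u) p = (Dy ^^ n) ((Dx ^^ m) u) p"
  using assms
proof (induction m)
  case (Suc m)
  have u: "Ck (Suc n) ((Dx ^^ m) u)" using Suc.prems by (intro C_k_on_dx_iter) simp
  have "\<forall>p\<in>R. (Dx ^^ m) ((Dy ^^ n) u) p = (Dy ^^ n) ((Dx ^^ m) u) p"
    by (intro Suc.IH C_k_on_mono[OF Suc.prems]) simp
  from dx_iter_cong[OF this, of 1] show ?case
    using dx_dy_iter_commute[OF u] by simp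
qed simp

text \<open>Phases and amplitude are free because differentiation shifts a phase by \<open>\<pi> / 2\<close> and scales the amplitude;
  the family is then closed under both partial derivatives.\<close>

lemma C_k_on_sin_sin: "Ck k (\<lambda>(x, y). A * sin (p * x + r) * sin (q * y + s))"
proof (induction k arbitrary: A r s)
  case 0
  show ?case unfolding C_k_on.simps case_prod_beta by (intro continuous_intros)
next
  case (Suc k)
  let ?w = "\<lambda>(x, y). A * sin (p * x + r) * sin (q * y + s)"
  have shift: "cos t = sin (t + pi / 2)" for t :: real by (simp add: sin_add)
  have "((\<lambda>t. ?w (t, y)) has_real_derivative A * p * sin (p * x + (r + pi / 2)) * sin (q * y + s)) (at x within {a..b})"
       "((\<lambda>t. ?w (x, t)) has_real_derivative A * q * sin (p * x + r) * sin (q * y + (s + pi / 2))) (at y within {c..d})"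
    for x y
    by (auto intro!: derivative_eq_intros simp: shift add.assoc)
  note deriv = this
  have kx: "Ck k (Dx ?w)"
  proof (rule C_k_on_cong)
    show "Ck k (\<lambda>(x, y). A * p * sin (p * x + (r + pi / 2)) * sin (q * y + s))" by (rule Suc.IH)
    show "\<forall>z\<in>R. (\<lambda>(x, y). A * p * sin (p * x + (r + pi / 2)) * sin (q * y + s)) z = Dx ?w z"
      using dx_eqI[OF deriv(1)] by force
  qed
  have ky: "Ck k (Dy ?w)"
  proof (rule C_k_on_cong)
    show "Ck k (\<lambda>(x, y). A * q * sin (p * x + r) * sin (q * y + (s + pi / 2)))" by (rule Suc.IH)
    show "\<forall>z\<in>R. (\<lambda>(x, y). A * q * sin (p * x + r) * sin (q * y + (s + pi / 2))) z = Dy ?w z"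
      using dy_eqI[OF deriv(2)] by force
  qed
  have cont: "continuous_on R ?w"
    unfolding case_prod_beta by (intro continuous_intros)
  have diff: "(\<lambda>t. ?w (t, y)) differentiable (at x within {a..b})"
    "(\<lambda>t. ?w (x, t)) differentiable (at y within {c..d})" for x y
    using deriv[THEN has_field_derivative_imp_has_derivative] unfolding differentiable_def by blast+
  show ?case unfolding C_k_on.simps by (intro conjI ballI cont kx ky diff)
qed

lemma laplace_sin_sin:
  fixes \<mu> \<nu> :: real
  assumes "p \<in> R"
  defines "w \<equiv> \<lambda>(x, y). sin (\<mu> * (x - a)) * sin (\<nu> * (y - c))"
  shows "(Dx ^^ 2) w p + (Dy ^^ 2) w p = - (\<mu>\<^sup>2 + \<nu>\<^sup>2) * w p"
proof -
  obtain x y where p: "p = (x, y)" and x: "x \<in> {a..b}" and y: "y \<in> {c..d}" using assms by auto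
  have "Dx w (t, y) = \<mu> * cos (\<mu> * (t - a)) * sin (\<nu> * (y - c))" if "t \<in> {a..b}" for t
    using that by (intro dx_eqI) (auto simp: w_def intro!: derivative_eq_intros)
  then have "Dx (Dx w) (x, y) = Dx (\<lambda>(t, y). \<mu> * cos (\<mu> * (t - a)) * sin (\<nu> * (y - c))) (x, y)"
    using x by (intro dx_cong) auto
  also have "\<dots> = - \<mu>\<^sup>2 * w (x, y)"
    using x by (intro dx_eqI) (auto simp: w_def power2_eq_square intro!: derivative_eq_intros)
  finally have xx: "Dx (Dx w) (x, y) = - \<mu>\<^sup>2 * w (x, y)" .
  have "Dy w (x, t) = \<nu> * sin (\<mu> * (x - a)) * cos (\<nu> * (t - c))" if "t \<in> {c..d}" for t
    using that by (intro dy_eqI) (auto simp: w_def intro!: derivative_eq_intros)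
  then have "Dy (Dy w) (x, y) = Dy (\<lambda>(x, t). \<nu> * sin (\<mu> * (x - a)) * cos (\<nu> * (t - c))) (x, y)"
    using y by (intro dy_cong) auto
  also have "\<dots> = - \<nu>\<^sup>2 * w (x, y)"
    using y by (intro dy_eqI) (auto simp: w_def power2_eq_square intro!: derivative_eq_intros)
  finally show ?thesis using xx by (simp add: p numeral_2_eq_2 algebra_simps)
qed

lemma closure_interior_R: "closure (interior R) = R"
  using ab cd by (simp add: interior_Times closure_Times)

lemma frontier_R: "frontier R = R - {a<..<b} \<times> {c<..<d}"
  by (simp add: frontier_def closure_Times interior_Times)

text \<open>Both sides are continuous on the closed rectangle, which is the closure of its interior.\<close>

lemma helmholtz_on_closed_rectangle:
  assumes "C_k_on 0 {a..b} {c..d} f" "Ck 2 u" "helmholtz_dirichlet K {a..b} {c..d} f \<Phi> u" "p \<in> R"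
  shows "f p = (Dx ^^ 2) u p + (Dy ^^ 2) u p + K\<^sup>2 * u p"
proof -
  define g where "g = (\<lambda>p. (Dx ^^ 2) u p + (Dy ^^ 2) u p + K\<^sup>2 * u p - f p)"
  have "continuous_on (closure (interior R)) g"
    unfolding closure_interior_R g_def using assms(1,2)
    by (auto intro!: continuous_intros simp: numeral_2_eq_2)
  moreover have "g q = 0" if "q \<in> interior R" for q
    using assms(3) that by (simp add: helmholtz_dirichlet_def g_def)
  moreover have "p \<in> closure (interior R)" using assms(4) closure_interior_R by simp
  ultimately have "g p = 0" by (rule continuous_constant_on_closure)
  then show ?thesis by (simp add: g_def)
qed

text \<open>At resonance the Dirichlet eigenfunction \<open>w\<close> could be added to \<open>u\<close> without changing the boundary values or
  the equation, but it is \<open>1\<close> at its first crest.\<close>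

lemma unique_imp_nonresonant:
  assumes square: "b - a = L" "d - c = L"
    and u: "Ck 8 u" "helmholtz_dirichlet K {a..b} {c..d} f \<Phi> u"
    and unique: "\<And>v. Ck 8 v \<Longrightarrow> helmholtz_dirichlet K {a..b} {c..d} f \<Phi> v \<Longrightarrow> (\<forall>p\<in>R. v p = u p)"
    and mn: "m \<ge> 1" "n \<ge> (1 :: nat)"
  shows "K\<^sup>2 \<noteq> (pi / L)\<^sup>2 * ((real m)\<^sup>2 + (real n)\<^sup>2)"
proof
  assume K: "K\<^sup>2 = (pi / L)\<^sup>2 * ((real m)\<^sup>2 + (real n)\<^sup>2)"
  have L: "L > 0" using ab square by simp
  define \<mu> \<nu> where "\<mu> = pi * real m / L" and "\<nu> = pi * real n / L"
  have K\<mu>\<nu>: "K\<^sup>2 = \<mu>\<^sup>2 + \<nu>\<^sup>2"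
    by (simp add: K \<mu>_def \<nu>_def power_divide power_mult_distrib distrib_left)
  define w where "w = (\<lambda>(x, y). sin (\<mu> * (x - a)) * sin (\<nu> * (y - c)))"
  define v where "v = (\<lambda>p. 1 * u p + 1 * w p)"
  have "w = (\<lambda>(x, y). 1 * sin (\<mu> * x + (- \<mu> * a)) * sin (\<nu> * y + (- \<nu> * c)))"
    by (simp add: w_def algebra_simps)
  then have w: "Ck k w" for k by (simp only: C_k_on_sin_sin)
  have v: "Ck 8 v" unfolding v_def by (intro C_k_on_lincomb u w)
  have u2: "Ck 2 u" using u(1) C_k_on_mono by fastforce
  have "helmholtz_dirichlet K {a..b} {c..d} f \<Phi> v"
    unfolding helmholtz_dirichlet_def
  proof (intro conjI ballI)
    fix p assume "p \<in> interior R"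
    then have pR: "p \<in> R" using interior_subset by blast
    have "(Dx ^^ 2) v p + (Dy ^^ 2) v p + K\<^sup>2 * v p
        = ((Dx ^^ 2) u p + (Dy ^^ 2) u p + K\<^sup>2 * u p) + ((Dx ^^ 2) w p + (Dy ^^ 2) w p + K\<^sup>2 * w p)"
      unfolding v_def
        dx_iter_lincomb[OF u2 w, THEN bspec, OF pR] dy_iter_lincomb[OF u2 w, THEN bspec, OF pR]
      by (simp add: distrib_left)
    also have "(Dx ^^ 2) w p + (Dy ^^ 2) w p + K\<^sup>2 * w p = 0"
      using laplace_sin_sin[OF pR, of \<mu> \<nu>] unfolding K\<mu>\<nu> w_def[symmetric] by algebra
    finally show "(Dx ^^ 2) v p + (Dy ^^ 2) v p + K\<^sup>2 * v p = f p"
      using u(2) \<open>p \<in> interior R\<close> by (simp add: helmholtz_dirichlet_def)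
  next
    fix p assume p: "p \<in> frontier R"
    have "\<mu> * (b - a) = real m * pi" "\<nu> * (d - c) = real n * pi"
      using L square by (simp_all add: \<mu>_def \<nu>_def)
    then have "sin (\<mu> * (b - a)) = 0" "sin (\<nu> * (d - c)) = 0"
      by (simp_all only: sin_npi)
    then have "w p = 0"
      using p unfolding frontier_R w_def by (cases p) (auto simp: not_less antisym)
    then show "v p = \<Phi> p" using u(2) p by (simp add: v_def helmholtz_dirichlet_def)
  qed
  from unique[OF v this] have w0: "\<forall>p\<in>R. w p = 0" by (simp add: v_def)
  \<comment> \<open>There both arguments of the sine are \<open>\<pi> / 2\<close>.\<close>
  define p where "p = (a + L / (2 * real m), c + L / (2 * real n))"
  have "L / (2 * real k) \<le> L" "0 \<le> L / (2 * real k)" if "k \<ge> 1" for k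
    using L that by (simp_all add: field_simps)
  then have "p \<in> R" using square mn by (auto simp: p_def algebra_simps)
  moreover have "w p = 1"
    using L mn by (simp add: w_def p_def \<mu>_def \<nu>_def)
  ultimately show False using w0 by simp
qed

end

section \<open>Taylor expansion of difference quotients\<close>

lemma taylor_even_part:
  fixes g :: "nat \<Rightarrow> real" and h :: real
  shows "(\<Sum>i<2 * p. g i * h ^ i / fact i) + (\<Sum>i<2 * p. g i * (- h) ^ i / fact i)
       = (\<Sum>k<p. 2 * h ^ (2 * k) / fact (2 * k) * g (2 * k))"
proof (induction p)
  case (Suc p)
  then show ?case by (simp add: algebra_simps)
qed simp

text \<open>The coefficient of the derivative of order \<open>2 k\<close> in the Taylor expansion of the second difference quotient.
  It is \<open>1\<close> for \<open>k = 1\<close>, so sums over \<open>k \<ge> 1\<close> start with the second derivative.\<close>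

definition taylor_coeff :: "real \<Rightarrow> nat \<Rightarrow> real" where
  "taylor_coeff h k = 2 * h ^ (2 * k - 2) / fact (2 * k)"

text \<open>The sequence \<open>G\<close> lists a function and its successive derivatives within \<open>S\<close>, so that \<open>x - h\<close> or \<open>x + h\<close> may
  be an end point of \<open>S\<close>.  Odd terms cancel between the two Taylor polynomials, and a remainder of order
  \<open>2 p\<close>, divided by \<open>h\<^sup>2\<close>, leaves \<open>h\<close> to the power \<open>2 p - 2\<close>.\<close>

lemma second_difference_taylor:
  fixes G :: "nat \<Rightarrow> real \<Rightarrow> real"
  assumes p: "p \<ge> 1" and S: "convex S" and h: "h > 0" and x: "x - h \<in> S" "x \<in> S" "x + h \<in> S"
    and deriv: "\<And>i t. t \<in> S \<Longrightarrow> i < 2 * p \<Longrightarrow> (G i has_real_derivative G (Suc i) t) (at t within S)"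
    and B: "\<And>t. t \<in> S \<Longrightarrow> \<bar>G (2 * p) t\<bar> \<le> B"
  shows "\<bar>(G 0 (x - h) - 2 * G 0 x + G 0 (x + h)) / h\<^sup>2 - (\<Sum>k\<in>{1..<p}. taylor_coeff h k * G (2 * k) x)\<bar>
      \<le> 2 * B * h ^ (2 * p - 2)"
proof -
  define n where "n = 2 * p - 1"
  have n: "Suc n = 2 * p" using p by (simp add: n_def)
  have B0: "B \<ge> 0" using B[OF x(2)] by linarith
  have T: "\<bar>G 0 z - (\<Sum>i<2 * p. G i x * (z - x) ^ i / fact i)\<bar> \<le> B * h ^ (2 * p)"
    if "z \<in> S" "\<bar>z - x\<bar> = h" for z
  proof -
    have "norm (G 0 z - (\<Sum>i\<le>n. G i x * (z - x) ^ i / fact i)) \<le> B * norm (z - x) ^ (Suc n) / fact n"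
      by (rule field_Taylor[OF S]) (use deriv B x that n in auto)
    also have "\<dots> \<le> B * norm (z - x) ^ (Suc n) / 1"
      using B0 by (intro divide_left_mono) auto
    finally show ?thesis using that by (simp add: n[symmetric] lessThan_Suc_atMost)
  qed
  define E where "E = (\<Sum>k\<in>{1..<p}. taylor_coeff h k * G (2 * k) x)"
  have split: "{..<p} = insert 0 {1..<p}" using p by auto
  have "(\<Sum>i<2 * p. G i x * h ^ i / fact i) + (\<Sum>i<2 * p. G i x * (- h) ^ i / fact i)
      = 2 * G 0 x + (\<Sum>k\<in>{1..<p}. 2 * h ^ (2 * k) / fact (2 * k) * G (2 * k) x)"
    unfolding taylor_even_part split by simp
  also have "(\<Sum>k\<in>{1..<p}. 2 * h ^ (2 * k) / fact (2 * k) * G (2 * k) x) = h\<^sup>2 * E"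
    unfolding E_def sum_distrib_left
  proof (rule sum.cong[OF refl])
    fix k assume "k \<in> {1..<p}"
    then have "h ^ (2 * k) = h\<^sup>2 * h ^ (2 * k - 2)" by (cases k) (simp_all add: power2_eq_square)
    then show "2 * h ^ (2 * k) / fact (2 * k) * G (2 * k) x = h\<^sup>2 * (taylor_coeff h k * G (2 * k) x)"
      by (simp add: taylor_coeff_def)
  qed
  finally have sums: "(\<Sum>i<2 * p. G i x * h ^ i / fact i) + (\<Sum>i<2 * p. G i x * (- h) ^ i / fact i)
      = 2 * G 0 x + h\<^sup>2 * E" .
  have "\<bar>G 0 (x - h) - 2 * G 0 x + G 0 (x + h) - h\<^sup>2 * E\<bar> \<le> 2 * (B * h ^ (2 * p))"
    using T[of "x + h"] T[of "x - h"] x h sums by (simp add: abs_le_iff)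
  also have "\<dots> = h\<^sup>2 * (2 * B * h ^ (2 * p - 2))"
    using p by (cases p) (simp_all add: power2_eq_square)
  finally have "\<bar>G 0 (x - h) - 2 * G 0 x + G 0 (x + h) - h\<^sup>2 * E\<bar> / h\<^sup>2 \<le> 2 * B * h ^ (2 * p - 2)"
    using h by (simp add: divide_le_eq mult.commute)
  moreover have "(G 0 (x - h) - 2 * G 0 x + G 0 (x + h)) / h\<^sup>2 - E
      = (G 0 (x - h) - 2 * G 0 x + G 0 (x + h) - h\<^sup>2 * E) / h\<^sup>2"
    using h by (simp add: field_simps)
  ultimately show ?thesis unfolding E_def[symmetric] using h by (simp add: abs_divide)
qed

text \<open>The difference quotients \<open>\<delta>x2\<close> and \<open>\<delta>y2\<close> for functions of a continuous variable, so that they can be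
  centred at any point and differentiated.\<close>

definition ddx :: "real \<Rightarrow> (real \<times> real \<Rightarrow> real) \<Rightarrow> real \<times> real \<Rightarrow> real" where
  "ddx h w = (\<lambda>(x, y). (w (x - h, y) - 2 * w (x, y) + w (x + h, y)) / h\<^sup>2)"

definition ddy :: "real \<Rightarrow> (real \<times> real \<Rightarrow> real) \<Rightarrow> real \<times> real \<Rightarrow> real" where
  "ddy h w = (\<lambda>(x, y). (w (x, y - h) - 2 * w (x, y) + w (x, y + h)) / h\<^sup>2)"

context rectangle
begin

text \<open>The steps and centres for which the nine-point stencil lies in the closed rectangle.\<close>

definition stencil :: "(real \<times> real \<times> real) set" where
  "stencil = {(h, x, y). h > 0 \<and> x - h \<in> {a..b} \<and> x + h \<in> {a..b} \<and> y - h \<in> {c..d} \<and> y + h \<in> {c..d}}"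

lemma bounded_on_R:
  assumes "Ck k w"
  obtains B where "\<And>p. p \<in> R \<Longrightarrow> \<bar>w p\<bar> \<le> B"
proof -
  have "bounded (w ` R)"
    using C_k_on_continuous[OF assms] by (intro compact_imp_bounded compact_continuous_image compact_Times compact_Icc)
  then show ?thesis using that unfolding bounded_iff by (metis imageI real_norm_def)
qed

lemma ddx_taylor:
  assumes w: "Ck (2 * p) w" and p: "p \<ge> 1"
  obtains B where "\<And>h x y. h > 0 \<Longrightarrow> x - h \<in> {a..b} \<Longrightarrow> x + h \<in> {a..b} \<Longrightarrow> y \<in> {c..d} \<Longrightarrow>
    \<bar>ddx h w (x, y) - (\<Sum>k\<in>{1..<p}. taylor_coeff h k * (Dx ^^ (2 * k)) w (x, y))\<bar> \<le> B * h ^ (2 * p - 2)"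
proof -
  have "Ck 0 ((Dx ^^ (2 * p)) w)" using w by (intro C_k_on_dx_iter) simp
  from bounded_on_R[OF this] obtain B where B: "\<And>q. q \<in> R \<Longrightarrow> \<bar>(Dx ^^ (2 * p)) w q\<bar> \<le> B" by blast
  show thesis
  proof (rule that)
    fix h x y assume hxy: "h > 0" "x - h \<in> {a..b}" "x + h \<in> {a..b}" "y \<in> {c..d}"
    let ?G = "\<lambda>i t. (Dx ^^ i) w (t, y)"
    have "\<bar>(?G 0 (x - h) - 2 * ?G 0 x + ?G 0 (x + h)) / h\<^sup>2 - (\<Sum>k\<in>{1..<p}. taylor_coeff h k * ?G (2 * k) x)\<bar>
        \<le> 2 * B * h ^ (2 * p - 2)"
    proof (rule second_difference_taylor[OF p])
      show "convex {a..b}" "h > 0" "x - h \<in> {a..b}" "x \<in> {a..b}" "x + h \<in> {a..b}" using hxy by auto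
      show "\<bar>?G (2 * p) t\<bar> \<le> B" if "t \<in> {a..b}" for t using that hxy by (intro B) auto
      fix i t assume t: "t \<in> {a..b}" and i: "i < 2 * p"
      have "Ck (i + Suc 0) w" by (rule C_k_on_mono[OF w]) (use i in simp)
      from has_dx[OF C_k_on_dx_iter[OF this] t hxy(4)]
      show "(?G i has_real_derivative ?G (Suc i) t) (at t within {a..b})" by simp
    qed
    then show "\<bar>ddx h w (x, y) - (\<Sum>k\<in>{1..<p}. taylor_coeff h k * (Dx ^^ (2 * k)) w (x, y))\<bar>
        \<le> 2 * B * h ^ (2 * p - 2)"
      by (simp only: ddx_def prod.case funpow_0)
  qed
qed

lemma ddy_taylor:
  assumes w: "Ck (2 * p) w" and p: "p \<ge> 1"
  obtains B where "\<And>h x y. h > 0 \<Longrightarrow> x \<in> {a..b} \<Longrightarrow> y - h \<in> {c..d} \<Longrightarrow> y + h \<in> {c..d} \<Longrightarrow>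
    \<bar>ddy h w (x, y) - (\<Sum>k\<in>{1..<p}. taylor_coeff h k * (Dy ^^ (2 * k)) w (x, y))\<bar> \<le> B * h ^ (2 * p - 2)"
proof -
  have "Ck 0 ((Dy ^^ (2 * p)) w)" using w by (intro C_k_on_dy_iter) simp
  from bounded_on_R[OF this] obtain B where B: "\<And>q. q \<in> R \<Longrightarrow> \<bar>(Dy ^^ (2 * p)) w q\<bar> \<le> B" by blast
  show thesis
  proof (rule that)
    fix h x y assume hxy: "h > 0" "x \<in> {a..b}" "y - h \<in> {c..d}" "y + h \<in> {c..d}"
    let ?G = "\<lambda>i t. (Dy ^^ i) w (x, t)"
    have "\<bar>(?G 0 (y - h) - 2 * ?G 0 y + ?G 0 (y + h)) / h\<^sup>2 - (\<Sum>k\<in>{1..<p}. taylor_coeff h k * ?G (2 * k) y)\<bar>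
        \<le> 2 * B * h ^ (2 * p - 2)"
    proof (rule second_difference_taylor[OF p])
      show "convex {c..d}" "h > 0" "y - h \<in> {c..d}" "y \<in> {c..d}" "y + h \<in> {c..d}" using hxy by auto
      show "\<bar>?G (2 * p) t\<bar> \<le> B" if "t \<in> {c..d}" for t using that hxy by (intro B) auto
      fix i t assume t: "t \<in> {c..d}" and i: "i < 2 * p"
      have "Ck (i + Suc 0) w" by (rule C_k_on_mono[OF w]) (use i in simp)
      from has_dy[OF C_k_on_dy_iter[OF this] hxy(2) t]
      show "(?G i has_real_derivative ?G (Suc i) t) (at t within {c..d})" by simp
    qed
    then show "\<bar>ddy h w (x, y) - (\<Sum>k\<in>{1..<p}. taylor_coeff h k * (Dy ^^ (2 * k)) w (x, y))\<bar>
        \<le> 2 * B * h ^ (2 * p - 2)"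
      by (simp only: ddy_def prod.case funpow_0)
  qed
qed

text \<open>The remainder of the expansion in \<open>y\<close> is a \<open>C\<^sup>2\<close> function \<open>G 0\<close> of \<open>x\<close>.  Its second derivative is the same
  remainder for \<open>\<partial>\<^sub>x\<^sup>2 w\<close>, because mixed derivatives commute; hence it is bounded by
  \<open>ddy_taylor\<close>, and so is the second difference of \<open>G 0\<close>, without any loss of powers of \<open>h\<close>.\<close>

lemma ddx_ddy_taylor:
  assumes w: "Ck (2 * p + 2) w" and p: "p \<ge> 1"
  obtains B where "\<And>h x y. (h, x, y) \<in> stencil \<Longrightarrow>
    \<bar>ddx h (ddy h w) (x, y) - (\<Sum>k\<in>{1..<p}. taylor_coeff h k * ddx h ((Dy ^^ (2 * k)) w) (x, y))\<bar> \<le> B * h ^ (2 * p - 2)"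
proof -
  have w2: "Ck (2 * p) ((Dx ^^ 2) w)" using w by (intro C_k_on_dx_iter) (simp add: add.commute)
  from ddy_taylor[OF this p] obtain B where B: "\<And>h x y. h > 0 \<Longrightarrow> x \<in> {a..b} \<Longrightarrow> y - h \<in> {c..d} \<Longrightarrow> y + h \<in> {c..d} \<Longrightarrow>
    \<bar>ddy h ((Dx ^^ 2) w) (x, y) - (\<Sum>k\<in>{1..<p}. taylor_coeff h k * (Dy ^^ (2 * k)) ((Dx ^^ 2) w) (x, y))\<bar> \<le> B * h ^ (2 * p - 2)"
    by blast
  show thesis
  proof (rule that)
    fix h x y assume "(h, x, y) \<in> stencil"
    then have h: "h > 0" and x: "x - h \<in> {a..b}" "x \<in> {a..b}" "x + h \<in> {a..b}"
      and y: "y - h \<in> {c..d}" "y \<in> {c..d}" "y + h \<in> {c..d}"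
      by (auto simp: stencil_def)
    let ?W = "\<lambda>i. (Dx ^^ i) w"
    define G where "G = (\<lambda>i t. ddy h (?W i) (t, y) - (\<Sum>k\<in>{1..<p}. taylor_coeff h k * (Dy ^^ (2 * k)) (?W i) (t, y)))"
    have "\<bar>(G 0 (x - h) - 2 * G 0 x + G 0 (x + h)) / h\<^sup>2 - (\<Sum>k\<in>{1..<1}. taylor_coeff h k * G (2 * k) x)\<bar>
        \<le> 2 * (B * h ^ (2 * p - 2)) * h ^ (2 * 1 - 2)"
    proof (rule second_difference_taylor)
      show "\<bar>G (2 * 1) t\<bar> \<le> B * h ^ (2 * p - 2)" if "t \<in> {a..b}" for t
        using B[OF h that y(1,3)] by (simp add: G_def)
      fix i t assume t: "t \<in> {a..b}" and i: "i < 2 * (1 :: nat)"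
      have Wi: "Ck (Suc (2 * p)) (?W i)"
        by (rule C_k_on_dx_iter, rule C_k_on_mono[OF w]) (use i in simp)
      have d: "((\<lambda>t. ?W i (t, s)) has_real_derivative ?W (Suc i) (t, s)) (at t within {a..b})" if "s \<in> {c..d}" for s
        using has_dx[OF Wi t that] by simp
      have dy: "((\<lambda>t. (Dy ^^ (2 * k)) (?W i) (t, y)) has_real_derivative (Dy ^^ (2 * k)) (?W (Suc i)) (t, y)) (at t within {a..b})"
        if "k \<in> {1..<p}" for k
      proof -
        have Wk: "Ck (2 * k + Suc 0) (?W i)" by (rule C_k_on_mono[OF Wi]) (use that in simp)
        have "Dx ((Dy ^^ (2 * k)) (?W i)) (t, y) = (Dy ^^ (2 * k)) (Dx (?W i)) (t, y)"
          using dx_dy_iter_commute[of "2 * k" "?W i"] Wk t y by simp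
        then show ?thesis using has_dx[OF C_k_on_dy_iter[OF Wk] t y(2)] by simp
      qed
      show "(G i has_real_derivative G (Suc i) t) (at t within {a..b})"
        unfolding G_def ddy_def prod.case
        by (intro DERIV_diff DERIV_add DERIV_cmult DERIV_sum DERIV_cdivide d dy y)
    qed (use h x in auto)
    moreover have "(G 0 (x - h) - 2 * G 0 x + G 0 (x + h)) / h\<^sup>2
      = ddx h (ddy h w) (x, y) - (\<Sum>k\<in>{1..<p}. taylor_coeff h k * ddx h ((Dy ^^ (2 * k)) w) (x, y))"
    proof -
      have "(\<Sum>k\<in>{1..<p}. taylor_coeff h k * ddx h ((Dy ^^ (2 * k)) w) (x, y)) =
         ((\<Sum>k\<in>{1..<p}. taylor_coeff h k * (Dy ^^ (2 * k)) w (x - h, y))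
          - 2 * (\<Sum>k\<in>{1..<p}. taylor_coeff h k * (Dy ^^ (2 * k)) w (x, y))
          + (\<Sum>k\<in>{1..<p}. taylor_coeff h k * (Dy ^^ (2 * k)) w (x + h, y))) / h\<^sup>2"
        unfolding ddx_def prod.case sum_distrib_left[of 2] sum_subtractf[symmetric] sum.distrib[symmetric] sum_divide_distrib
        by (rule sum.cong[OF refl]) (simp add: algebra_simps)
      then show ?thesis
        unfolding G_def ddx_def prod.case funpow_0 by (simp add: diff_divide_distrib add_divide_distrib)
    qed
    ultimately show "\<bar>ddx h (ddy h w) (x, y) - (\<Sum>k\<in>{1..<p}. taylor_coeff h k * ddx h ((Dy ^^ (2 * k)) w) (x, y))\<bar>
        \<le> 2 * B * h ^ (2 * p - 2)"
      by simp
  qed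
qed

text \<open>The Landau class with respect to the principal filter of \<open>stencil\<close> expresses a bound that is uniform in the
  step and in the centre, and not only in the limit of small steps.\<close>

abbreviation order_h :: "nat \<Rightarrow> (real \<times> real \<times> real \<Rightarrow> real) set" where
  "order_h n \<equiv> O[principal stencil](\<lambda>z. fst z ^ n)"

lemma order_hI:
  assumes "\<And>h x y. (h, x, y) \<in> stencil \<Longrightarrow> \<bar>F (h, x, y)\<bar> \<le> B * h ^ n"
  shows "F \<in> order_h n"
proof (rule bigoI)
  show "\<forall>\<^sub>F z in principal stencil. norm (F z) \<le> B * norm (fst z ^ n)"
    unfolding eventually_principal using assms by (auto simp: stencil_def power_abs split: prod.splits)
qed

lemma order_hE:
  assumes "F \<in> order_h n"
  obtains B where "\<And>h x y. (h, x, y) \<in> stencil \<Longrightarrow> \<bar>F (h, x, y)\<bar> \<le> B * h ^ n"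
proof -
  from landau_o.bigE[OF assms] obtain B where "\<forall>z\<in>stencil. norm (F z) \<le> B * norm (fst z ^ n)"
    unfolding eventually_principal by blast
  then have "\<bar>F (h, x, y)\<bar> \<le> B * h ^ n" if "(h, x, y) \<in> stencil" for h x y
    using that by (force simp: stencil_def)
  then show thesis by (rule that)
qed

text \<open>Surplus powers of \<open>h\<close> can be absorbed into the constant because \<open>h \<le> b - a\<close> on \<open>stencil\<close>.\<close>

lemma order_h_scale:
  assumes "F \<in> order_h m" "n \<le> k + m"
  shows "(\<lambda>z. C * fst z ^ k * F z) \<in> order_h n"
proof -
  from order_hE[OF assms(1)] obtain B where B: "\<And>h x y. (h, x, y) \<in> stencil \<Longrightarrow> \<bar>F (h, x, y)\<bar> \<le> B * h ^ m" by blast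
  define l where "l = k + m - n"
  show ?thesis
  proof (rule order_hI)
    fix h x y assume z: "(h, x, y) \<in> stencil"
    then have h: "0 < h" "h \<le> b - a" by (auto simp: stencil_def)
    have F0: "0 \<le> B * h ^ m" using B[OF z] by linarith
    then have B0: "0 \<le> B" 
      using mult_neg_pos[of B "h ^ m"] zero_less_power[OF h(1), of m] by linarith
    have "\<bar>C * h ^ k * F (h, x, y)\<bar> \<le> \<bar>C\<bar> * h ^ k * (B * h ^ m)"
      using B[OF z] h by (simp add: abs_mult mult_left_mono)
    also have "\<dots> = \<bar>C\<bar> * B * h ^ l * h ^ n"
      using assms(2) by (simp add: l_def power_add[symmetric] mult_ac)
    also have "\<dots> \<le> \<bar>C\<bar> * B * (b - a) ^ l * h ^ n"
      using h B0 by (intro mult_right_mono mult_left_mono power_mono) auto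
    finally show "\<bar>C * fst (h, x, y) ^ k * F (h, x, y)\<bar> \<le> \<bar>C\<bar> * B * (b - a) ^ l * h ^ n" by simp
  qed
qed

lemma order_h_ddx:
  assumes "Ck (2 * p) w" "p \<ge> 1"
  shows "(\<lambda>z. ddx (fst z) w (snd z) - (\<Sum>k\<in>{1..<p}. taylor_coeff (fst z) k * (Dx ^^ (2 * k)) w (snd z))) \<in> order_h (2 * p - 2)"
proof -
  from ddx_taylor[OF assms] obtain B where B: "\<And>h x y. h > 0 \<Longrightarrow> x - h \<in> {a..b} \<Longrightarrow> x + h \<in> {a..b} \<Longrightarrow> y \<in> {c..d} \<Longrightarrow>
    \<bar>ddx h w (x, y) - (\<Sum>k\<in>{1..<p}. taylor_coeff h k * (Dx ^^ (2 * k)) w (x, y))\<bar> \<le> B * h ^ (2 * p - 2)" by blast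
  show ?thesis
    by (rule order_hI[of _ B]) (unfold fst_conv snd_conv, rule B, auto simp: stencil_def)
qed

lemma order_h_ddy:
  assumes "Ck (2 * p) w" "p \<ge> 1"
  shows "(\<lambda>z. ddy (fst z) w (snd z) - (\<Sum>k\<in>{1..<p}. taylor_coeff (fst z) k * (Dy ^^ (2 * k)) w (snd z))) \<in> order_h (2 * p - 2)"
proof -
  from ddy_taylor[OF assms] obtain B where B: "\<And>h x y. h > 0 \<Longrightarrow> x \<in> {a..b} \<Longrightarrow> y - h \<in> {c..d} \<Longrightarrow> y + h \<in> {c..d} \<Longrightarrow>
    \<bar>ddy h w (x, y) - (\<Sum>k\<in>{1..<p}. taylor_coeff h k * (Dy ^^ (2 * k)) w (x, y))\<bar> \<le> B * h ^ (2 * p - 2)" by blast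
  show ?thesis
    by (rule order_hI[of _ B]) (unfold fst_conv snd_conv, rule B, auto simp: stencil_def)
qed

lemma order_h_ddx_ddy:
  assumes "Ck (2 * p + 2) w" "p \<ge> 1"
  shows "(\<lambda>z. ddx (fst z) (ddy (fst z) w) (snd z)
    - (\<Sum>k\<in>{1..<p}. taylor_coeff (fst z) k * ddx (fst z) ((Dy ^^ (2 * k)) w) (snd z))) \<in> order_h (2 * p - 2)"
proof -
  from ddx_ddy_taylor[OF assms] obtain B where B: "\<And>h x y. (h, x, y) \<in> stencil \<Longrightarrow>
    \<bar>ddx h (ddy h w) (x, y) - (\<Sum>k\<in>{1..<p}. taylor_coeff h k * ddx h ((Dy ^^ (2 * k)) w) (x, y))\<bar> \<le> B * h ^ (2 * p - 2)" by blast
  show ?thesis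
    by (rule order_hI[of _ B]) (unfold fst_conv snd_conv, rule B)
qed

lemma order_h_0:
  assumes "Ck k w"
  shows "(\<lambda>z. w (snd z)) \<in> order_h 0"
proof -
  from bounded_on_R[OF assms] obtain B where B: "\<And>p. p \<in> R \<Longrightarrow> \<bar>w p\<bar> \<le> B" by blast
  show ?thesis
    by (rule order_hI[of _ B]) (unfold fst_conv snd_conv power_0 mult_1_right, rule B, auto simp: stencil_def)
qed

end

section \<open>Truncation error of the scheme\<close>

context rectangle
begin

abbreviation DD :: "nat \<Rightarrow> nat \<Rightarrow> (real \<times> real \<Rightarrow> real) \<Rightarrow> real \<times> real \<Rightarrow> real" where
  "DD i j w \<equiv> (Dx ^^ i) ((Dy ^^ j) w)"

lemma C_k_on_DD: "Ck (i + j + k) w \<Longrightarrow> Ck k (DD i j w)"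
  by (intro C_k_on_dx_iter C_k_on_dy_iter) (simp add: ac_simps)

lemma DD_DD:
  assumes "Ck (i + j + k + l) w" "p \<in> R"
  shows "DD i j (DD k l w) p = DD (i + k) (j + l) w p"
proof -
  have "Ck (k + j) ((Dy ^^ l) w)"
    by (rule C_k_on_dy_iter, rule C_k_on_mono[OF assms(1)]) simp
  from dx_iter_dy_iter_commute[OF this]
  have "\<forall>p\<in>R. (Dy ^^ j) ((Dx ^^ k) ((Dy ^^ l) w)) p = (Dx ^^ k) ((Dy ^^ j) ((Dy ^^ l) w)) p"
    by (intro ballI) (rule sym, erule bspec)
  from dx_iter_cong[OF this, of i, THEN bspec, OF assms(2)] show ?thesis by (simp only: funpow_add o_apply)
qed

lemma DD_lincomb:
  assumes "Ck (i + j) u" "Ck (i + j) v" "p \<in> R"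
  shows "DD i j (\<lambda>p. \<alpha> * u p + \<beta> * v p) p = \<alpha> * DD i j u p + \<beta> * DD i j v p"
proof -
  have uv: "Ck j u" "Ck j v"
    by (rule C_k_on_mono[OF assms(1)], simp, rule C_k_on_mono[OF assms(2)], simp)
  have uv': "Ck i ((Dy ^^ j) u)" "Ck i ((Dy ^^ j) v)"
    by (rule C_k_on_dy_iter, rule C_k_on_mono[OF assms(1)], simp,
        rule C_k_on_dy_iter, rule C_k_on_mono[OF assms(2)], simp)
  have "DD i j (\<lambda>p. \<alpha> * u p + \<beta> * v p) p = (Dx ^^ i) (\<lambda>p. \<alpha> * (Dy ^^ j) u p + \<beta> * (Dy ^^ j) v p) p"
    by (rule dx_iter_cong[OF dy_iter_lincomb[OF uv], THEN bspec, OF assms(3)])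
  also have "\<dots> = \<alpha> * DD i j u p + \<beta> * DD i j v p"
    by (rule dx_iter_lincomb[OF uv', THEN bspec, OF assms(3)])
  finally show ?thesis .
qed

text \<open>Moving all \<open>x\<close>-derivatives to the front brings every derivative of \<open>f\<close> into a form that
  the cancellation identity of the scheme can use.\<close>

lemma DD_helmholtz_rhs:
  assumes u: "Ck (i + j + 2) u" and p: "p \<in> R"
    and f: "\<And>p. p \<in> R \<Longrightarrow> f p = (Dx ^^ 2) u p + (Dy ^^ 2) u p + K\<^sup>2 * u p"
  shows "DD i j f p = DD (i + 2) j u p + DD i (j + 2) u p + K\<^sup>2 * DD i j u p"
proof -
  define g where "g = (\<lambda>p. 1 * DD 2 0 u p + 1 * DD 0 2 u p)"
  have xx: "Ck (i + j) (DD 2 0 u)" and yy: "Ck (i + j) (DD 0 2 u)"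
    by (rule C_k_on_DD, rule C_k_on_mono[OF u], simp)+
  then have g: "Ck (i + j) g" unfolding g_def by (rule C_k_on_lincomb)
  have u': "Ck (i + j) u" by (rule C_k_on_mono[OF u]) simp
  have "\<forall>p\<in>R. f p = 1 * g p + K\<^sup>2 * u p" 
    by (intro ballI) (simp only: g_def funpow_0 mult_1_left f)
  then have "DD i j f p = DD i j (\<lambda>p. 1 * g p + K\<^sup>2 * u p) p"
    by (rule dx_iter_cong[OF dy_iter_cong, THEN bspec, OF _ p])
  also have "\<dots> = DD i j g p + K\<^sup>2 * DD i j u p" using DD_lincomb[OF g u' p, of 1 "K\<^sup>2"] by (simp only: mult_1_left)
  also have "DD i j g p = DD i j (DD 2 0 u) p + DD i j (DD 0 2 u) p"
    unfolding g_def using DD_lincomb[OF xx yy p, of 1 1] by (simp only: mult_1_left)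
  also have "DD i j (DD 2 0 u) p = DD (i + 2) j u p" 
    using DD_DD[OF _ p, of i j 2 0 u] u by (simp only: add_0_right)
  also have "DD i j (DD 0 2 u) p = DD i (j + 2) u p" 
    using DD_DD[OF _ p, of i j 0 2 u] u by (simp only: add_0_right)
  finally show ?thesis .
qed

end

text \<open>The algebra behind the scheme.  The variables \<open>Mij\<close> stand for \<open>\<partial>\<^sub>x\<^sup>i \<partial>\<^sub>y\<^sup>j u\<close>, and a prefix \<open>X\<close> or \<open>Y\<close> for a second
  difference quotient in that direction.  The hypotheses are the differential equation and its derivatives.
  On the right each product is a power of \<open>h\<close> times either the remainder of a Taylor expansion or a bounded
  quantity, of total order \<open>h\<^sup>6\<close> or more.\<close>

lemma compact_scheme_cancellation:
  fixes K h u :: real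
  assumes "f = M20 + M02 + K\<^sup>2 * u"
    and "fxx = M40 + M22 + K\<^sup>2 * M20" and "fyy = M22 + M04 + K\<^sup>2 * M02"
    and "fxxxx = M60 + M42 + K\<^sup>2 * M40" and "fxxyy = M42 + M24 + K\<^sup>2 * M22" and "fyyyy = M24 + M06 + K\<^sup>2 * M04"
  shows "- \<alpha>1 K h * (Xu + Yu) - \<alpha>2 K h * XYu - K\<^sup>2 * \<alpha>3 K h * u
     - (- \<beta>1 K h * f - \<beta>2 K h * (Xf + Yf) - \<beta>3 K h * XYf - \<beta>4 K h * (fxx + fyy) - \<beta>5 K h * (Xfxx + Yfyy))
   = (-1) * h^0 * (Xu - (M20 + h\<^sup>2 / 12 * M40 + h^4 / 360 * M60))
   + (-1) * h^0 * (Yu - (M02 + h\<^sup>2 / 12 * M04 + h^4 / 360 * M06))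
   + (-1/6) * h\<^sup>2 * (XYu - (XM02 + h\<^sup>2 / 12 * XM04))
   + (-K\<^sup>2/180) * h^4 * (XYu - (XM02 + h\<^sup>2 / 12 * XM04))
   + (-1/6) * h\<^sup>2 * (XM02 - (M22 + h\<^sup>2 / 12 * M42))
   + (-K\<^sup>2/180) * h^4 * (XM02 - (M22 + h\<^sup>2 / 12 * M42))
   + (-1/72) * h^4 * (XM04 - M24)
   + (-K\<^sup>2/2160) * h^6 * (XM04 - M24)
   + (1/90) * h^4 * (XYf - Xfyy)
   + (1/90) * h^4 * (Xfyy - fxxyy)
   + (1/360) * h^4 * (Xfxx - fxxxx)
   + (1/360) * h^4 * (Yfyy - fyyyy)
   + (- (K^6) / 20160) * h^6 * Xu + (- (K^6) / 20160) * h^6 * Yu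
   + (-K\<^sup>2/2160) * h^6 * M42 + (-K\<^sup>2/2160) * h^6 * M24
   + (- (K^4) / 5040) * h^6 * XYu
   + (K^4/20160) * h^6 * Xf + (K^4/20160) * h^6 * Yf
   + (K\<^sup>2/10080) * h^6 * XYf
   + (-K\<^sup>2/20160) * h^6 * Xfxx + (-K\<^sup>2/20160) * h^6 * Yfyy"
  unfolding assms \<alpha>1_def \<alpha>2_def \<alpha>3_def \<beta>1_def \<beta>2_def \<beta>3_def \<beta>4_def \<beta>5_def
  by (simp add: algebra_simps add_divide_distrib diff_divide_distrib eval_nat_numeral)

context rectangle
begin

definition truncation_error :: "real \<Rightarrow> (real \<times> real \<Rightarrow> real) \<Rightarrow> (real \<times> real \<Rightarrow> real) \<Rightarrow> real \<times> real \<times> real \<Rightarrow> real" where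
  "truncation_error K u f = (\<lambda>(h, p).
     - \<alpha>1 K h * (ddx h u p + ddy h u p) - \<alpha>2 K h * ddx h (ddy h u) p - K\<^sup>2 * \<alpha>3 K h * u p
     - (- \<beta>1 K h * f p - \<beta>2 K h * (ddx h f p + ddy h f p) - \<beta>3 K h * ddx h (ddy h f) p
        - \<beta>4 K h * ((Dx ^^ 2) f p + (Dy ^^ 2) f p)
        - \<beta>5 K h * (ddx h ((Dx ^^ 2) f) p + ddy h ((Dy ^^ 2) f) p)))"

text \<open>Every term of \<open>compact_scheme_cancellation\<close> is at least of order \<open>h\<^sup>6\<close>.  The expansion of the mixed difference
  is split into three: first in \<open>y\<close>, then in \<open>x\<close> for each of the two leading terms.\<close>

lemma truncation_error_order_6:
  assumes u: "Ck 8 u" and f: "Ck 6 f"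
    and helmholtz: "\<And>p. p \<in> R \<Longrightarrow> f p = (Dx ^^ 2) u p + (Dy ^^ 2) u p + K\<^sup>2 * u p"
  shows "truncation_error K u f \<in> order_h 6"
proof -
  have t: "taylor_coeff h 1 = 1" "taylor_coeff h 2 = h\<^sup>2 / 12" "taylor_coeff h 3 = h ^ 4 / 360" for h
    by (simp_all add: taylor_coeff_def fact_numeral)
  have i: "{1..<1} = ({} :: nat set)" "{1..<2} = {1 :: nat}" "{1..<3} = {1, 2 :: nat}" "{1..<4} = {1, 2, 3 :: nat}"
    by auto
  have sums: "(\<Sum>k\<in>{1..<1}. g k) = (0 :: real)" "(\<Sum>k\<in>{1..<2}. g k) = g 1" "(\<Sum>k\<in>{1..<3}. g k) = g 1 + g 2"
    "(\<Sum>k\<in>{1..<4}. g k) = g 1 + (g 2 + g 3)" for g :: "nat \<Rightarrow> real"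
    unfolding i by simp_all
  have arith: "2 * 1 = (2 :: nat)" "2 * 2 = (4 :: nat)" "2 * 3 = (6 :: nat)" "2 * 4 = (8 :: nat)"
    "4 - 2 = (2 :: nat)" "6 - 2 = (4 :: nat)" "8 - 2 = (6 :: nat)" "2 - 2 = (0 :: nat)"
    "2 + 2 = (4 :: nat)" "4 + 2 = (6 :: nat)" "6 + 2 = (8 :: nat)" by simp_all
  note expand = arith sums t mult_1_left diff_zero add.assoc
  note X = order_h_ddx[of 1, unfolded expand] order_h_ddx[of 2, unfolded expand]
           order_h_ddx[of 3, unfolded expand] order_h_ddx[of 4, unfolded expand]
  note Y = order_h_ddy[of 1, unfolded expand] order_h_ddy[of 2, unfolded expand]
           order_h_ddy[of 3, unfolded expand] order_h_ddy[of 4, unfolded expand]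
  note XY = order_h_ddx_ddy[of 1, unfolded expand] order_h_ddx_ddy[of 2, unfolded expand]
           order_h_ddx_ddy[of 3, unfolded expand]
  have Cu: "Ck k (DD i j u)" if "i + j + k \<le> 8" for i j k
    by (rule C_k_on_DD, rule C_k_on_mono[OF u that])
  have Cf: "Ck k (DD i j f)" if "i + j + k \<le> 6" for i j k
    by (rule C_k_on_DD, rule C_k_on_mono[OF f that])
  note reg = Cu[of 0 0, unfolded funpow_0] Cu[of 0, unfolded funpow_0] Cf[of 0 0, unfolded funpow_0]
    Cf[of 0, unfolded funpow_0] Cf[of _ 0, unfolded funpow_0] Cu

  have orders:
    "(\<lambda>z. ddx (fst z) u (snd z) - ((Dx ^^ 2) u (snd z) + ((fst z)\<^sup>2 / 12 * (Dx ^^ 4) u (snd z) + (fst z) ^ 4 / 360 * (Dx ^^ 6) u (snd z)))) \<in> order_h 6"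
    "(\<lambda>z. ddy (fst z) u (snd z) - ((Dy ^^ 2) u (snd z) + ((fst z)\<^sup>2 / 12 * (Dy ^^ 4) u (snd z) + (fst z) ^ 4 / 360 * (Dy ^^ 6) u (snd z)))) \<in> order_h 6"
    "(\<lambda>z. ddx (fst z) (ddy (fst z) u) (snd z) - (ddx (fst z) ((Dy ^^ 2) u) (snd z) + (fst z)\<^sup>2 / 12 * ddx (fst z) ((Dy ^^ 4) u) (snd z))) \<in> order_h 4"
    "(\<lambda>z. ddx (fst z) ((Dy ^^ 2) u) (snd z) - (DD 2 2 u (snd z) + (fst z)\<^sup>2 / 12 * DD 4 2 u (snd z))) \<in> order_h 4"
    "(\<lambda>z. ddx (fst z) ((Dy ^^ 4) u) (snd z) - DD 2 4 u (snd z)) \<in> order_h 2"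
    "(\<lambda>z. ddx (fst z) (ddy (fst z) f) (snd z) - ddx (fst z) ((Dy ^^ 2) f) (snd z)) \<in> order_h 2"
    "(\<lambda>z. ddx (fst z) ((Dy ^^ 2) f) (snd z) - DD 2 2 f (snd z)) \<in> order_h 2"
    "(\<lambda>z. ddx (fst z) ((Dx ^^ 2) f) (snd z) - (Dx ^^ 2) ((Dx ^^ 2) f) (snd z)) \<in> order_h 2"
    "(\<lambda>z. ddy (fst z) ((Dy ^^ 2) f) (snd z) - (Dy ^^ 2) ((Dy ^^ 2) f) (snd z)) \<in> order_h 2"
    "(\<lambda>z. ddx (fst z) u (snd z)) \<in> order_h 0" "(\<lambda>z. ddy (fst z) u (snd z)) \<in> order_h 0"
    "(\<lambda>z. DD 4 2 u (snd z)) \<in> order_h 0" "(\<lambda>z. DD 2 4 u (snd z)) \<in> order_h 0"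
    "(\<lambda>z. ddx (fst z) (ddy (fst z) u) (snd z)) \<in> order_h 0"
    "(\<lambda>z. ddx (fst z) f (snd z)) \<in> order_h 0" "(\<lambda>z. ddy (fst z) f (snd z)) \<in> order_h 0"
    "(\<lambda>z. ddx (fst z) (ddy (fst z) f) (snd z)) \<in> order_h 0"
    "(\<lambda>z. ddx (fst z) ((Dx ^^ 2) f) (snd z)) \<in> order_h 0" "(\<lambda>z. ddy (fst z) ((Dy ^^ 2) f) (snd z)) \<in> order_h 0"
    by (rule X(4) Y(4) XY(3) X(3) X(2) XY(2) Y(2) X(1) Y(1) XY(1) order_h_0[of 2], (rule reg)?; simp)+

  \<comment> \<open>The right-hand side of \<open>compact_scheme_cancellation\<close>.\<close>
  define S where "S = (\<lambda>z :: real \<times> real \<times> real. let h = fst z; p = snd z in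
     (-1) * h^0 * (ddx h u p - ((Dx ^^ 2) u p + (h\<^sup>2 / 12 * (Dx ^^ 4) u p + h^4 / 360 * (Dx ^^ 6) u p)))
   + (-1) * h^0 * (ddy h u p - ((Dy ^^ 2) u p + (h\<^sup>2 / 12 * (Dy ^^ 4) u p + h^4 / 360 * (Dy ^^ 6) u p)))
   + (-1/6) * h\<^sup>2 * (ddx h (ddy h u) p - (ddx h ((Dy ^^ 2) u) p + h\<^sup>2 / 12 * ddx h ((Dy ^^ 4) u) p))
   + (-K\<^sup>2/180) * h^4 * (ddx h (ddy h u) p - (ddx h ((Dy ^^ 2) u) p + h\<^sup>2 / 12 * ddx h ((Dy ^^ 4) u) p))
   + (-1/6) * h\<^sup>2 * (ddx h ((Dy ^^ 2) u) p - (DD 2 2 u p + h\<^sup>2 / 12 * DD 4 2 u p))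
   + (-K\<^sup>2/180) * h^4 * (ddx h ((Dy ^^ 2) u) p - (DD 2 2 u p + h\<^sup>2 / 12 * DD 4 2 u p))
   + (-1/72) * h^4 * (ddx h ((Dy ^^ 4) u) p - DD 2 4 u p)
   + (-K\<^sup>2/2160) * h^6 * (ddx h ((Dy ^^ 4) u) p - DD 2 4 u p)
   + (1/90) * h^4 * (ddx h (ddy h f) p - ddx h ((Dy ^^ 2) f) p)
   + (1/90) * h^4 * (ddx h ((Dy ^^ 2) f) p - DD 2 2 f p)
   + (1/360) * h^4 * (ddx h ((Dx ^^ 2) f) p - (Dx ^^ 2) ((Dx ^^ 2) f) p)
   + (1/360) * h^4 * (ddy h ((Dy ^^ 2) f) p - (Dy ^^ 2) ((Dy ^^ 2) f) p)
   + (- (K^6) / 20160) * h^6 * ddx h u p + (- (K^6) / 20160) * h^6 * ddy h u p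
   + (-K\<^sup>2/2160) * h^6 * DD 4 2 u p + (-K\<^sup>2/2160) * h^6 * DD 2 4 u p
   + (- (K^4) / 5040) * h^6 * ddx h (ddy h u) p
   + (K^4/20160) * h^6 * ddx h f p + (K^4/20160) * h^6 * ddy h f p
   + (K\<^sup>2/10080) * h^6 * ddx h (ddy h f) p
   + (-K\<^sup>2/20160) * h^6 * ddx h ((Dx ^^ 2) f) p + (-K\<^sup>2/20160) * h^6 * ddy h ((Dy ^^ 2) f) p)"
  have "S \<in> order_h 6"
    unfolding S_def Let_def by (intro sum_in_bigo(1); (rule order_h_scale, rule orders, simp))
  then obtain B where B: "\<And>h x y. (h, x, y) \<in> stencil \<Longrightarrow> \<bar>S (h, x, y)\<bar> \<le> B * h ^ 6"
    by (rule order_hE) blast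
  have "truncation_error K u f (h, x, y) = S (h, x, y)" if z: "(h, x, y) \<in> stencil" for h x y
  proof -
    have p: "(x, y) \<in> R" using z by (auto simp: stencil_def)
    have Df: "DD i j f (x, y) = DD (i + 2) j u (x, y) + DD i (j + 2) u (x, y) + K\<^sup>2 * DD i j u (x, y)"
      if "i + j \<le> 6" for i j
      using that by (intro DD_helmholtz_rhs C_k_on_mono[OF u] p helmholtz) auto
    have plus: "0 + 2 = (2 :: nat)" "2 + 2 = (4 :: nat)" "4 + 2 = (6 :: nat)" by simp_all
    have four: "(Dx ^^ 2) ((Dx ^^ 2) f) = (Dx ^^ 4) f" "(Dy ^^ 2) ((Dy ^^ 2) f) = (Dy ^^ 4) f"
      by (simp_all add: eval_nat_numeral)
    show ?thesis
      unfolding truncation_error_def S_def Let_def prod.case fst_conv snd_conv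
      using Df[of 0 0] Df[of 2 0] Df[of 0 2] Df[of 4 0] Df[of 2 2] Df[of 0 4]
      unfolding plus funpow_0 four add.assoc[symmetric]
      by (intro compact_scheme_cancellation) (simp_all add: add_ac)
  qed
  with B show ?thesis by (intro order_hI) (simp only:)
qed

end

section \<open>Convergence\<close>

lemma \<delta>x2_grid:
  assumes "i \<ge> 1"
  shows "\<delta>x2 h (\<lambda>i j. w (grid_pt a c h i j)) i j = ddx h w (grid_pt a c h i j)"
  using assms by (simp add: \<delta>x2_def ddx_def grid_pt_def of_nat_diff algebra_simps)

lemma \<delta>y2_grid:
  assumes "j \<ge> 1"
  shows "\<delta>y2 h (\<lambda>i j. w (grid_pt a c h i j)) i j = ddy h w (grid_pt a c h i j)"
  using assms by (simp add: \<delta>y2_def ddy_def grid_pt_def of_nat_diff algebra_simps)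

lemma \<delta>x2_\<delta>y2_grid:
  assumes "i \<ge> 1" "j \<ge> 1"
  shows "\<delta>x2 h (\<delta>y2 h (\<lambda>i j. w (grid_pt a c h i j))) i j = ddx h (ddy h w) (grid_pt a c h i j)"
proof -
  have "\<delta>x2 h (\<delta>y2 h (\<lambda>i j. w (grid_pt a c h i j))) i j = \<delta>x2 h (\<lambda>i j. ddy h w (grid_pt a c h i j)) i j"
    unfolding \<delta>x2_def[of h _ i j] \<delta>y2_grid[OF assms(2)] ..
  then show ?thesis by (simp only: \<delta>x2_grid[OF assms(1)])
qed

lemma scheme_op_diff:
  "scheme_op K h (\<lambda>i j. v i j - w i j) i j = scheme_op K h v i j - scheme_op K h w i j"
  by (simp add: scheme_op_def \<delta>x2_def \<delta>y2_def algebra_simps add_divide_distrib diff_divide_distrib)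

lemma (in rectangle) scheme_op_error:
  assumes "difference_scheme K a b c d f \<Phi> N h U" "i \<in> {1..<N}" "j \<in> {1..<N}"
  shows "scheme_op K h (\<lambda>i j. u (grid_pt a c h i j) - U i j) i j = truncation_error K u f (h, grid_pt a c h i j)"
proof -
  have ij: "i \<ge> 1" "j \<ge> 1" "i \<in> {1..N - 1}" "j \<in> {1..N - 1}" using assms by auto
  then have "scheme_op K h U i j = scheme_rhs K h (\<lambda>i j. f (grid_pt a c h i j))
      (\<lambda>i j. (Dx ^^ 2) f (grid_pt a c h i j)) (\<lambda>i j. (Dy ^^ 2) f (grid_pt a c h i j)) i j"
    using assms(1) unfolding difference_scheme_def by blast
  then show ?thesis
    unfolding scheme_op_diff
    by (simp only: scheme_rhs_def scheme_op_def[of K h "\<lambda>i j. u (grid_pt a c h i j)"] truncation_error_def prod.case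
        \<delta>x2_\<delta>y2_grid[OF ij(1,2)] \<delta>x2_grid[OF ij(1)] \<delta>y2_grid[OF ij(2)])
qed

lemma (in rectangle) grid_pt_stencil:
  assumes "h > 0" "a + real N * h = b" "c + real N * h = d" "i \<in> {1..<N}" "j \<in> {1..<N}"
  shows "(h, grid_pt a c h i j) \<in> stencil"
proof -
  have "h \<le> real k * h \<and> real k * h + h \<le> real N * h" if "k \<in> {1..<N}" for k
  proof
    show "h \<le> real k * h" using that assms(1) by simp
    have "(real k + 1) * h \<le> real N * h" using that assms(1) by (intro mult_right_mono) auto
    then show "real k * h + h \<le> real N * h" by (simp add: algebra_simps)
  qed
  from this[OF assms(4)] this[OF assms(5)] show ?thesis
    using assms(1-3) by (auto simp: stencil_def grid_pt_def)
qed

lemma (in rectangle) grid_error_zero_boundary: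
  assumes "h > 0" "a + real N * h = b" "c + real N * h = d"
    and "difference_scheme K a b c d f \<Phi> N h U" "helmholtz_dirichlet K {a..b} {c..d} f \<Phi> u"
  shows "zero_boundary N (\<lambda>i j. u (grid_pt a c h i j) - U i j)"
proof -
  have zero: "u (grid_pt a c h i j) - U i j = 0"
    if ij: "i \<le> N" "j \<le> N" and bd: "i = 0 \<or> i = N \<or> j = 0 \<or> j = N" for i j
  proof -
    have "0 \<le> real k * h \<and> real k * h \<le> real N * h" if "k \<le> N" for k
      using that assms(1) by (auto intro: mult_right_mono)
    from this[OF ij(1)] this[OF ij(2)] have "grid_pt a c h i j \<in> R"
      using assms(2,3) by (auto simp: grid_pt_def)
    moreover have "grid_pt a c h i j \<notin> {a<..<b} \<times> {c<..<d}"
      using bd assms(2,3) by (auto simp: grid_pt_def)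
    ultimately have "grid_pt a c h i j \<in> frontier R" by (simp add: frontier_R)
    then have "u (grid_pt a c h i j) = \<Phi> (grid_pt a c h i j)"
      using assms(5) unfolding helmholtz_dirichlet_def by blast
    moreover have "U i j = \<Phi> (grid_pt a c h i j)"
    proof -
      have "\<forall>i\<in>{0..N}. \<forall>j\<in>{0..N}. i = 0 \<or> i = N \<or> j = 0 \<or> j = N \<longrightarrow> U i j = \<Phi> (grid_pt a c h i j)"
        using assms(4) unfolding difference_scheme_def by (rule conjunct2)
      moreover have "i \<in> {0..N}" "j \<in> {0..N}" using ij by simp_all
      ultimately show ?thesis using bd by (simp only: Ball_def)
    qed
    ultimately show ?thesis by simp
  qed
  then show ?thesis by (simp add: zero_boundary_def)
qed

theorem theorem4p6:
  fixes a b c d K :: real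
    and f u \<Phi> :: "real \<times> real \<Rightarrow> real"
  assumes "a < b" and "c < d"
    and "C_k_on 6 {a..b} {c..d} f"
    and "C_k_on 8 {a..b} {c..d} u"
    and "helmholtz_dirichlet K {a..b} {c..d} f \<Phi> u"
    and unique: "\<And>v. C_k_on 8 {a..b} {c..d} v \<Longrightarrow> helmholtz_dirichlet K {a..b} {c..d} f \<Phi> v \<Longrightarrow>
                   (\<forall>p\<in>{a..b} \<times> {c..d}. v p = u p)"
  shows "\<exists>\<epsilon>>0. \<exists>C1 C2. \<forall>N h U.
           h > 0 \<longrightarrow> a + real N * h = b \<longrightarrow> c + real N * h = d \<longrightarrow>
           0 < K * h \<longrightarrow> K * h < \<epsilon> \<longrightarrow>
           difference_scheme K a b c d f \<Phi> N h U \<longrightarrow>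
           grid_error a c N h u U \<le> C1 * h^6 + C2 * h^6 * interior_deriv_norm a b c d N h 8 u"
proof (cases "K > 0 \<and> b - a = d - c")
  \<comment> \<open>Otherwise no \<open>N\<close> and \<open>h\<close> satisfy the constraints of the conclusion.\<close>
  case False
  then show ?thesis
    by (intro exI[of _ 1]) (auto simp: zero_less_mult_iff)
next
  case True
  interpret rectangle a b c d using assms(1,2) by unfold_locales
  define L where "L = b - a"
  have L: "L > 0" "b - a = L" "d - c = L" using True assms(1) by (auto simp: L_def)
  have nonres: "K\<^sup>2 \<noteq> (pi / L)\<^sup>2 * ((real m)\<^sup>2 + (real n)\<^sup>2)" if "m \<ge> 1" "n \<ge> 1" for m n
    by (rule unique_imp_nonresonant[OF L(2,3) assms(4,5) unique that])
  obtain h0 \<gamma> where h0: "h0 > 0" and \<gamma>: "\<gamma> > 0"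
    and eig: "\<And>N h m n. h > 0 \<Longrightarrow> h < h0 \<Longrightarrow> real N * h = L \<Longrightarrow> m \<in> {1..<N} \<Longrightarrow> n \<in> {1..<N} \<Longrightarrow>
        \<bar>scheme_eig K h N m n\<bar> \<ge> \<gamma> * ((real m)\<^sup>2 + (real n)\<^sup>2)"
    by (rule scheme_eig_bounded_below[OF L(1) nonres]) blast+
  have f0: "C_k_on 0 {a..b} {c..d} f" and u2: "C_k_on 2 {a..b} {c..d} u"
    by (rule C_k_on_mono[OF assms(3)], simp, rule C_k_on_mono[OF assms(4)], simp)
  have "truncation_error K u f \<in> order_h 6"
    by (rule truncation_error_order_6[OF assms(4,3) helmholtz_on_closed_rectangle[OF f0 u2 assms(5)]])
  then obtain B where B: "\<And>h x y. (h, x, y) \<in> stencil \<Longrightarrow> \<bar>truncation_error K u f (h, x, y)\<bar> \<le> B * h ^ 6"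
    by (rule order_hE) blast
  define M where "M = max B 0"
  have bound: "grid_error a c N h u U \<le> 2 * M / \<gamma> * h ^ 6"
    if h: "h > 0" and grid: "a + real N * h = b" "c + real N * h = d" and small: "K * h < K * h0"
      and U: "difference_scheme K a b c d f \<Phi> N h U" for N h U
  proof -
    define v where "v = (\<lambda>i j. u (grid_pt a c h i j) - U i j)"
    have hN: "h < h0" "real N * h = L" "N > 0"
      using small True grid assms(1) by (simp_all add: L_def, cases N, simp_all)
    have v0: "zero_boundary N v"
      unfolding v_def by (rule grid_error_zero_boundary[OF h grid U assms(5)])
    have rhs: "0 \<le> 2 * M / \<gamma> * h ^ 6" using \<gamma> h by (simp add: M_def)
    have tau: "\<bar>scheme_op K h v i j\<bar> \<le> M * h ^ 6" if ij: "i \<in> {1..<N}" "j \<in> {1..<N}" for i j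
    proof -
      have "\<bar>scheme_op K h v i j\<bar> \<le> B * h ^ 6"
        unfolding v_def scheme_op_error[OF U ij]
        using B[of h "fst (grid_pt a c h i j)" "snd (grid_pt a c h i j)"] grid_pt_stencil[OF h grid ij] by simp
      also have "\<dots> \<le> M * h ^ 6" using h by (intro mult_right_mono) (auto simp: M_def)
      finally show ?thesis .
    qed
    have v: "\<bar>v i j\<bar> \<le> 2 * M / \<gamma> * h ^ 6" if "i \<le> N" "j \<le> N" for i j
    proof (cases "i \<in> {1..<N} \<and> j \<in> {1..<N}")
      case True
      then have ij: "i \<in> {1..<N}" "j \<in> {1..<N}" by simp_all
      have "\<bar>v i j\<bar> \<le> 2 * (M * h ^ 6) / \<gamma>"
        by (rule discrete_stability[OF hN(3) v0 tau \<gamma> eig[OF h hN(1,2)] ij])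
      then show ?thesis by simp
    next
      case False
      then have "i = 0 \<or> i = N \<or> j = 0 \<or> j = N" using that by auto
      then have "v i j = 0" using v0 that by (auto simp: zero_boundary_def)
      then show ?thesis using rhs by simp
    qed
    have set: "{\<bar>u (grid_pt a c h i j) - U i j\<bar> | i j. i \<in> {0..N} \<and> j \<in> {0..N}}
        = (\<lambda>(i, j). \<bar>v i j\<bar>) ` ({0..N} \<times> {0..N})"
      by (auto simp: v_def; blast)
    show ?thesis
      unfolding grid_error_def set using v by (subst Max_le_iff) auto
  qed
  \<comment> \<open>The derivatives of \<open>u\<close> and \<open>f\<close>, those of order \<open>8\<close> included, enter \<open>M\<close> through their maxima over the
    closed rectangle, which do not depend on \<open>h\<close>; so the whole error is charged to the first constant.\<close>
  show ?thesis
  proof (rule exI[of _ "K * h0"], rule conjI, goal_cases)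
    case 1
    show ?case using True h0 by simp
  next
    case 2
    show ?case
      by (rule exI[of _ "2 * M / \<gamma>"], rule exI[of _ 0]) (use bound in simp)
  qed
qed

end
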